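(* For each Dyck word $w$ in the alphabet $\{x,D\}$ and each integer $k\geq 0$, $$\sum_{P \in \mathcal{P}(w,k)} q^{\mathrm{wt}(P)} = S_w^q(k).$$
   Context: $q$-Stirling numbers. Let $q$ be an indeterminate. The $q$-deformed Weyl algebra on $\{x,D\}$ is generated by $x,D$ subject to $Dx=qxD+1$. For a word $w$ with equally many $x$'s and $D$'s, there is a unique expansion in this algebra $w=\sum_{k\ge0}S^q_w(k)x^kD^k$, where each $S_w^q(k)$ is a polynomial in $q$ with non-negative integer coefficients. Dyck words. A word in $\{x,D\}$ is a Dyck word if it has the same number of $x$'s as $D$'s and every initial segment has at least as many $x$'s as $D$'s. A (non-empty) Dyck word is irreducible if it is $xD$ or is of the form $xw'D$ with $w'$ a non-empty Dyck word; otherwise it is reducible, and it is then uniquely $w_1\cdots w_\ell$ with each $w_i$ irreducible. Words here are non-empty. The graph $G_w$. For a Dyck word $w$: if $w=xD$, $G_w=K_1$; if $w=xw'D$ with $w'$ a non-empty Dyck word, $G_w$ is $G_{w'}$ with a dominating vertex added (a new vertex adjacent to all others); if $w=w_1\cdots w_\ell$ is reducible with each $w_i$ irreducible, $G_w$ is the disjoint union of $G_{w_1},\ldots,G_{w_\ell}$. $\mathcal{P}(w,k)$ denotes the set of partitions of the vertex set of $G_w$ into $k$ non-empty independent sets. Weight of a matrix. Let $M$ be an $r\times s$ matrix with entries in $\{0,1\}$ having at most one $1$ in each row and each column. Mark every $0$ of $M$ that is below a $1$ in the same column or to the right of a $1$ in the same row. Then $f(M)$ is the number of unmarked $0$'s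 of $M$. Weight of a partition. Fix an arbitrary total order on the set of independent sets of $G_w$; it induces total orders on the independent sets of subgraphs of $G_w$. For a partition $P$ of $G_w$ into non-empty independent sets, $\mathrm{wt}(P)$ is defined inductively: (1) If $w=xD$, then $\mathrm{wt}(P)=0$. (2) If $w=xw'D$ with $w'$ a non-empty Dyck word, then the added dominating vertex $v$ is a singleton part of $P$; let $\varphi(P)$ be the partition of $G_{w'}$ obtained by removing this part, and set $\mathrm{wt}(P)=\mathrm{wt}(\varphi(P))$. (3) If $w=w_1\cdots w_\ell$ is reducible with each $w_i$ irreducible, view $G_w$ as the disjoint union of $G_{w_1}$ and $G_{w_2\cdots w_\ell}$. Let $P_1$, with parts $x_1,\ldots,x_r$ in increasing order, and $P_2$, with parts $y_1,\ldots,y_s$ in increasing order, be the partitions of $G_{w_1}$ and $G_{w_2\cdots w_\ell}$ induced by $P$ (the non-empty intersections of the parts of $P$ with the respective vertex sets). Let $M$ be the $r\times s$ matrix whose $ij$ entry is $1$ if $x_i\cup y_j$ is a part of $P$ and $0$ otherwise. Set $\mathrm{wt}(P)=\mathrm{wt}(P_1)+\mathrm{wt}(P_2)+f(M)$. *)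

theory Defs
  imports
    "HOL-Library.Poly_Mapping"
    "HOL-Library.Disjoint_Sets"
    "HOL-Library.Sublist"
    "HOL-Computational_Algebra.Polynomial"
    "Jordan_Normal_Form.Matrix"
begin

section \<open>Words and the q-deformed Weyl algebra\<close>

datatype letter = X | D

text \<open>Lists form the free monoid under concatenation, written additively because
  \<^typ>\<open>'a \<Rightarrow>\<^sub>0 'b\<close> takes its exponents from an additive monoid. Hence
  \<^typ>\<open>letter list \<Rightarrow>\<^sub>0 int poly\<close> is the free associative algebra on \<^term>\<open>X\<close>, \<^term>\<open>D\<close>
  over the integer polynomials in the indeterminate q.\<close>

instantiation list :: (type) monoid_add
begin

definition zero_list_def: "0 = ([] :: 'a list)"

definition plus_list_def: "u + v = (u @ v :: 'a list)"

instance
  by standard (simp_all add: zero_list_def plus_list_def)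

end

type_synonym free_alg = "letter list \<Rightarrow>\<^sub>0 int poly"

definition free_word :: "letter list \<Rightarrow> free_alg" where
  "free_word w = Poly_Mapping.single w 1"

definition free_scalar :: "int poly \<Rightarrow> free_alg" where
  "free_scalar c = Poly_Mapping.single [] c"

definition q_var :: "int poly" where
  "q_var = [:0, 1:]"

inductive_set weyl_ideal :: "free_alg set" where
  relation: "free_word [D, X] - (free_scalar q_var * free_word [X, D] + 1) \<in> weyl_ideal"
| add: "a \<in> weyl_ideal \<Longrightarrow> b \<in> weyl_ideal \<Longrightarrow> a + b \<in> weyl_ideal"
| mult_left: "a \<in> weyl_ideal \<Longrightarrow> c * a \<in> weyl_ideal"
| mult_right: "a \<in> weyl_ideal \<Longrightarrow> a * c \<in> weyl_ideal"

definition weyl_cong :: "free_alg \<Rightarrow> free_alg \<Rightarrow> bool" where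
  "weyl_cong a b \<longleftrightarrow> a - b \<in> weyl_ideal"

lemma weyl_ideal_zero: "0 \<in> weyl_ideal"
  using weyl_ideal.mult_left[OF weyl_ideal.relation, of 0] by simp

lemma weyl_ideal_uminus: "a \<in> weyl_ideal \<Longrightarrow> - a \<in> weyl_ideal"
  using weyl_ideal.mult_left[of a "- 1"] by simp

lemma weyl_cong_add: "weyl_cong a b \<Longrightarrow> weyl_cong c d \<Longrightarrow> weyl_cong (a + c) (b + d)"
  unfolding weyl_cong_def by (metis add_diff_add weyl_ideal.add)

lemma weyl_cong_uminus: "weyl_cong a b \<Longrightarrow> weyl_cong (- a) (- b)"
  unfolding weyl_cong_def by (metis minus_diff_minus weyl_ideal_uminus)

lemma weyl_cong_mult:
  assumes "weyl_cong a b" "weyl_cong c d"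
  shows "weyl_cong (a * c) (b * d)"
proof -
  have "a * c - b * d = (a - b) * c + b * (c - d)"
    by (simp add: algebra_simps)
  then show ?thesis
    using assms unfolding weyl_cong_def
    by (simp add: weyl_ideal.add weyl_ideal.mult_left weyl_ideal.mult_right)
qed

lemma equivp_weyl_cong: "equivp weyl_cong"
proof (rule equivpI)
  show "reflp weyl_cong"
    by (simp add: reflp_def weyl_cong_def weyl_ideal_zero)
  show "symp weyl_cong"
    unfolding symp_def weyl_cong_def by (metis minus_diff_eq weyl_ideal_uminus)
  show "transp weyl_cong"
    unfolding transp_def weyl_cong_def using weyl_ideal.add by fastforce
qed

quotient_type q_weyl = free_alg / weyl_cong
  by (rule equivp_weyl_cong)

text \<open>The algebra is not the zero ring: specialise q to 0 and both letters to 1.\<close>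

definition trivial_eval :: "free_alg \<Rightarrow> int" where
  "trivial_eval a = (\<Sum>w. poly (Poly_Mapping.lookup a w) 0)"

lemma trivial_eval_add: "trivial_eval (a + b) = trivial_eval a + trivial_eval b"
proof -
  have "finite {w. poly (Poly_Mapping.lookup c w) 0 \<noteq> 0}" for c :: free_alg
    by (rule finite_subset[OF _ finite_lookup[of c]]) auto
  then show ?thesis
    unfolding trivial_eval_def by (simp add: lookup_add Sum_any.distrib)
qed

lemma trivial_eval_single: "trivial_eval (Poly_Mapping.single w c) = poly c 0"
  unfolding trivial_eval_def lookup_single by (simp add: when_def if_distrib[of "\<lambda>p. poly p 0"] cong: if_cong) 

lemma free_alg_induct [case_names single add]:
  assumes single: "\<And>w c. P (Poly_Mapping.single w c)"
    and add: "\<And>a b. P a \<Longrightarrow> P b \<Longrightarrow> P (a + b)"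
  shows "P (a :: free_alg)"
proof (induction a rule: update_induct)
  case const
  show ?case
    using single[of _ 0] by simp
next
  case (update f w c)
  have "Poly_Mapping.update w c f = f + Poly_Mapping.single w c"
    using update by (intro poly_mapping_eqI) (auto simp: lookup_update lookup_add lookup_single when_def in_keys_iff)
  then show ?case
    using update single add by simp
qed

lemma trivial_eval_mult: "trivial_eval (a * b) = trivial_eval a * trivial_eval b"
proof (induction a rule: free_alg_induct)
  case (single w c)
  show ?case
    by (induction b rule: free_alg_induct)
      (simp_all add: mult_single trivial_eval_single trivial_eval_add distrib_left)
qed (simp add: trivial_eval_add distrib_right)

lemma one_not_in_weyl_ideal: "1 \<notin> weyl_ideal"
proof
  have one: "trivial_eval 1 = 1"
    using trivial_eval_single[of 0 1] by simp
  have neg: "trivial_eval (- a) = - trivial_eval a" for a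
    using trivial_eval_add[of a "- a"] trivial_eval_single[of 0 0] by simp
  have "trivial_eval a = 0" if "a \<in> weyl_ideal" for a
    using that
  proof induction
    case relation
    show ?case
      using one by (simp only: diff_conv_add_uminus trivial_eval_add neg trivial_eval_mult)
        (simp add: free_word_def free_scalar_def q_var_def trivial_eval_single)
  qed (simp_all add: trivial_eval_add trivial_eval_mult)
  moreover assume "1 \<in> weyl_ideal"
  ultimately show False
    using one by force
qed

instantiation q_weyl :: ring_1
begin

lift_definition zero_q_weyl :: q_weyl is 0 .
lift_definition one_q_weyl :: q_weyl is 1 .
lift_definition plus_q_weyl :: "q_weyl \<Rightarrow> q_weyl \<Rightarrow> q_weyl" is "(+)"
  by (rule weyl_cong_add)
lift_definition uminus_q_weyl :: "q_weyl \<Rightarrow> q_weyl" is uminus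
  by (rule weyl_cong_uminus)
lift_definition minus_q_weyl :: "q_weyl \<Rightarrow> q_weyl \<Rightarrow> q_weyl" is "(-)"
  by (metis diff_conv_add_uminus weyl_cong_add weyl_cong_uminus)
lift_definition times_q_weyl :: "q_weyl \<Rightarrow> q_weyl \<Rightarrow> q_weyl" is "(*)"
  by (rule weyl_cong_mult)

instance
proof
  show "(0 :: q_weyl) \<noteq> 1"
    by transfer (use one_not_in_weyl_ideal weyl_ideal_uminus[of "- 1"] in \<open>auto simp: weyl_cong_def\<close>)
qed (transfer; simp add: weyl_cong_def algebra_simps weyl_ideal_zero)+

end

lift_definition weyl_word :: "letter list \<Rightarrow> q_weyl" is free_word .

lift_definition weyl_scalar :: "int poly \<Rightarrow> q_weyl" is free_scalar .

abbreviation weyl_x :: q_weyl where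
  "weyl_x \<equiv> weyl_word [X]"

abbreviation weyl_D :: q_weyl where
  "weyl_D \<equiv> weyl_word [D]"

lemma weyl_word_Nil: "weyl_word [] = 1"
  by transfer (simp add: free_word_def weyl_cong_def weyl_ideal_zero flip: zero_list_def)

lemma weyl_word_append: "weyl_word (u @ v) = weyl_word u * weyl_word v"
  by transfer
    (simp add: free_word_def mult_single weyl_cong_def weyl_ideal_zero flip: plus_list_def)

lemma weyl_relation: "weyl_D * weyl_x = weyl_scalar q_var * weyl_x * weyl_D + 1"
proof -
  have "weyl_word [D, X] = weyl_scalar q_var * weyl_word [X, D] + 1"
    by transfer (simp add: weyl_cong_def weyl_ideal.relation)
  then show ?thesis
    using weyl_word_append[of "[D]" "[X]"] weyl_word_append[of "[X]" "[D]"]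
    by (simp add: mult.assoc)
qed

text \<open>The coefficients of the unique normally ordered expansion; the value is unspecified unless
  \<^term>\<open>w\<close> has as many \<^term>\<open>X\<close>'s as \<^term>\<open>D\<close>'s.\<close>

definition q_stirling :: "letter list \<Rightarrow> nat \<Rightarrow> int poly" where
  "q_stirling w = (THE S. finite {k. S k \<noteq> 0} \<and>
     weyl_word w = (\<Sum>k | S k \<noteq> 0. weyl_scalar (S k) * weyl_x ^ k * weyl_D ^ k))"


section \<open>Dyck words\<close>

definition balanced :: "letter list \<Rightarrow> bool" where
  "balanced w \<longleftrightarrow> count_list w X = count_list w D"

definition dyck :: "letter list \<Rightarrow> bool" where
  "dyck w \<longleftrightarrow> w \<noteq> [] \<and> balanced w \<and>
     (\<forall>u. prefix u w \<longrightarrow> count_list u D \<le> count_list u X)"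

definition dyck_irreducible :: "letter list \<Rightarrow> bool" where
  "dyck_irreducible w \<longleftrightarrow> w = [X, D] \<or> (\<exists>w'. dyck w' \<and> w = X # w' @ [D])"

text \<open>Recovers \<^term>\<open>w'\<close> from \<^term>\<open>X # w' @ [D]\<close>.\<close>

definition dyck_inner :: "letter list \<Rightarrow> letter list" where
  "dyck_inner w = butlast (tl w)"

definition dyck_factors :: "letter list \<Rightarrow> letter list list" where
  "dyck_factors w = (THE ws. (\<forall>u \<in> set ws. dyck_irreducible u) \<and> concat ws = w)"

lemma dyck_irreducible_imp_dyck:
  assumes "dyck_irreducible w"
  shows "dyck w"
proof -
  consider "w = [X, D]" | w' where "dyck w'" "w = X # w' @ [D]"
    using assms unfolding dyck_irreducible_def by blast
  then show ?thesis
    by cases (auto simp: dyck_def balanced_def prefix_Cons prefix_append le_Suc_eq)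
qed

lemma dyck_irreducible_prefix:
  assumes "dyck_irreducible w" "prefix u w" "u \<noteq> []" "balanced u"
  shows "u = w"
proof -
  consider "w = [X, D]" | w' where "dyck w'" "w = X # w' @ [D]"
    using assms(1) unfolding dyck_irreducible_def by blast
  then show ?thesis
  proof cases
    case 1
    then show ?thesis
      using assms by (auto simp: prefix_Cons balanced_def)
  next
    case 2
    then obtain v where v: "u = X # v" "prefix v (w' @ [D])"
      using assms(2,3) by (auto simp: prefix_Cons)
    have "count_list v D = Suc (count_list v X)"
      using assms(4) v by (simp add: balanced_def)
    then have "\<not> prefix v w'"
      using 2 by (force simp: dyck_def)
    then show ?thesis
      using 2 v by simp
  qed
qed

lemma dyck_first_factor:
  assumes "dyck w"
  shows "\<exists>u v. w = u @ v \<and> dyck_irreducible u \<and> (v = [] \<or> dyck v)"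
proof -
  define P where "P u \<longleftrightarrow> prefix u w \<and> u \<noteq> [] \<and> balanced u" for u
  have "P w"
    using assms by (simp add: P_def dyck_def)
  then obtain u where u: "P u" and least: "\<And>t. P t \<Longrightarrow> length u \<le> length t"
    using ex_has_least_nat[of P w length] by blast
  obtain v where w: "w = u @ v"
    using u by (auto simp: P_def prefix_def)
  have bal: "balanced u" and ne: "u \<noteq> []"
    using u by (auto simp: P_def)
  have pre: "count_list t D \<le> count_list t X" if "prefix t w" for t
    using assms that by (simp add: dyck_def)
  have v: "v = [] \<or> dyck v"
  proof -
    have "count_list t D \<le> count_list t X" if "prefix t v" for t
      using pre[of "u @ t"] that bal by (simp add: w balanced_def)
    moreover have "balanced v"
      using assms bal by (simp add: dyck_def w balanced_def)
    ultimately show ?thesis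
      by (auto simp: dyck_def)
  qed
  obtain a r where ar: "u = a # r"
    using ne by (cases u) auto
  have "prefix [a] w"
    by (simp add: w ar)
  from pre[OF this] have a: "a = X"
    by (cases a) auto
  have "r \<noteq> []"
    using bal by (auto simp: ar a balanced_def)
  then obtain s b where sb: "r = s @ [b]"
    by (cases r rule: rev_cases) auto
  have inner: "count_list t D \<le> count_list t X" if "prefix t s" for t
  proof (rule ccontr)
    assume "\<not> ?thesis"
    moreover have pt: "prefix (X # t) w"
      using that by (auto simp: w ar a sb prefix_def)
    ultimately have "balanced (X # t)"
      using pre[OF pt] by (auto simp: balanced_def)
    then have "length u \<le> length (X # t)"
      using pt by (intro least) (simp add: P_def)
    then show False
      using prefix_length_le[OF that] by (simp add: ar sb)
  qed
  have b: "b = D"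
  proof (rule ccontr)
    assume "b \<noteq> D"
    then have "b = X"
      by (cases b) auto
    then show False
      using inner[of s] bal by (simp add: ar a sb balanced_def)
  qed
  have "balanced s"
    using bal by (simp add: ar a sb b balanced_def)
  then have "s = [] \<or> dyck s"
    using inner by (auto simp: dyck_def)
  then have "dyck_irreducible u"
    by (auto simp: dyck_irreducible_def ar a sb b)
  then show ?thesis
    using w v by blast
qed

lemma dyck_factors_exist:
  "dyck w \<Longrightarrow> \<exists>ws. (\<forall>u \<in> set ws. dyck_irreducible u) \<and> concat ws = w"
proof (induction "length w" arbitrary: w rule: less_induct)
  case less
  obtain u v where w: "w = u @ v" and u: "dyck_irreducible u" and v: "v = [] \<or> dyck v"
    using dyck_first_factor[OF less.prems] by blast
  have "u \<noteq> []"
    using u by (auto simp: dyck_irreducible_def)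
  from v show ?case
  proof
    assume "v = []"
    then show ?thesis
      using w u by (intro exI[of _ "[u]"]) simp
  next
    assume "dyck v"
    then obtain vs where "\<forall>u \<in> set vs. dyck_irreducible u" "concat vs = v"
      using less.hyps[of v] w \<open>u \<noteq> []\<close> by auto
    then show ?thesis
      using w u by (intro exI[of _ "u # vs"]) simp
  qed
qed

lemma dyck_factors_unique:
  assumes "\<forall>u \<in> set us. dyck_irreducible u" "\<forall>v \<in> set vs. dyck_irreducible v"
    and "concat us = concat vs"
  shows "us = vs"
  using assms
proof (induction us arbitrary: vs)
  case Nil
  then show ?case
    by (cases vs) (auto simp: dyck_irreducible_def)
next
  case (Cons u us)
  obtain v vs' where vs: "vs = v # vs'"
    using Cons.prems by (cases vs) (auto simp: dyck_irreducible_def)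
  have irr: "dyck_irreducible u" "dyck_irreducible v"
    using Cons.prems by (auto simp: vs)
  have "prefix u v \<or> prefix v u"
    using Cons.prems(3) by (metis concat.simps(2) prefixI prefix_same_cases vs)
  moreover have "u \<noteq> []" "balanced u" "v \<noteq> []" "balanced v"
    using irr[THEN dyck_irreducible_imp_dyck] by (auto simp: dyck_def)
  ultimately have "u = v"
    using irr dyck_irreducible_prefix by blast
  moreover have "us = vs'"
    using Cons.prems by (intro Cons.IH) (simp_all add: vs \<open>u = v\<close>)
  ultimately show ?case
    by (simp add: vs)
qed

lemma dyck_factors:
  assumes "dyck w"
  shows "\<forall>u \<in> set (dyck_factors w). dyck_irreducible u" "concat (dyck_factors w) = w"
proof -
  have "\<exists>!ws. (\<forall>u \<in> set ws. dyck_irreducible u) \<and> concat ws = w"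
    using dyck_factors_exist[OF assms] dyck_factors_unique by blast
  from theI'[OF this, folded dyck_factors_def]
  show "\<forall>u \<in> set (dyck_factors w). dyck_irreducible u" "concat (dyck_factors w) = w"
    by (rule conjunct1, rule conjunct2)
qed

lemma length_dyck_inner: "dyck_irreducible w \<Longrightarrow> length (dyck_inner w) < length w"
  by (auto simp: dyck_inner_def dyck_irreducible_def)

lemma length_dyck_factor:
  assumes "dyck w" "\<not> dyck_irreducible w" "i < length (dyck_factors w)"
  shows "length (dyck_factors w ! i) < length w"
proof -
  let ?ws = "dyck_factors w"
  note f = dyck_factors[OF assms(1)]
  have "concat (take i ?ws @ ?ws ! i # drop (Suc i) ?ws) = w"
    using f(2) id_take_nth_drop[OF assms(3)] by simp
  then have "length (concat (take i ?ws @ ?ws ! i # drop (Suc i) ?ws)) = length w"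
    by (rule arg_cong)
  then have len: "length w = length (concat (take i ?ws)) + length (?ws ! i)
      + length (concat (drop (Suc i) ?ws))"
    by (simp only: concat_append concat.simps length_append add.assoc)
  have ne: "[] \<notin> set ?ws"
    using f(1) by (auto simp: dyck_irreducible_def)
  have "take i ?ws \<noteq> [] \<or> drop (Suc i) ?ws \<noteq> []"
  proof (rule ccontr)
    assume "\<not> ?thesis"
    then have "take i ?ws = []" "drop (Suc i) ?ws = []"
      by blast+
    then have "?ws = [?ws ! i]"
      using id_take_nth_drop[OF assms(3)] by (simp only: append_Nil)
    then show False
      using f assms(2) by (metis append_Nil2 concat.simps list.set_intros(1))
  qed
  moreover have "concat vs \<noteq> []" if "vs \<noteq> []" "set vs \<subseteq> set ?ws" for vs
    using that ne by (cases vs) auto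
  ultimately have "concat (take i ?ws) \<noteq> [] \<or> concat (drop (Suc i) ?ws) \<noteq> []"
    using set_take_subset set_drop_subset by metis
  then show ?thesis
    using len by auto
qed

lemma length_dyck_split:
  assumes "dyck w" "\<not> dyck_irreducible w"
  shows "length (hd (dyck_factors w)) < length w"
    and "length (concat (tl (dyck_factors w))) < length w"
proof -
  have ne: "dyck_factors w \<noteq> []"
    using dyck_factors(2)[OF assms(1)] assms(1) by (auto simp: dyck_def)
  then show "length (hd (dyck_factors w)) < length w"
    using length_dyck_factor[OF assms, of 0] by (simp add: hd_conv_nth)
  obtain u us where us: "dyck_factors w = u # us"
    using ne by (cases "dyck_factors w") auto
  have "dyck_irreducible u" "w = u @ concat us"
    using dyck_factors[OF assms(1)] by (simp_all add: us)
  then have "length (concat us) < length w"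
    by (auto simp: dyck_irreducible_def)
  then show "length (concat (tl (dyck_factors w))) < length w"
    by (simp add: us)
qed


section \<open>The graph of a Dyck word\<close>

text \<open>A simple graph is a vertex set together with a set of two-element edges.\<close>

type_synonym 'a sgraph = "'a set \<times> 'a set set"

abbreviation verts :: "'a sgraph \<Rightarrow> 'a set" where
  "verts \<equiv> fst"

abbreviation edges :: "'a sgraph \<Rightarrow> 'a set set" where
  "edges \<equiv> snd"

definition add_dominating :: "'a \<Rightarrow> 'a sgraph \<Rightarrow> 'a sgraph" where
  "add_dominating v G = (insert v (verts G), edges G \<union> {{v, u} | u. u \<in> verts G})"

definition independent_set :: "'a sgraph \<Rightarrow> 'a set \<Rightarrow> bool" where
  "independent_set G I \<longleftrightarrow> I \<subseteq> verts G \<and> (\<forall>u \<in> I. \<forall>v \<in> I. {u, v} \<notin> edges G)"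

text \<open>The vertices of \<^term>\<open>dyck_graph_at n w\<close> are the positions of the letters \<^term>\<open>X\<close> of
  \<^term>\<open>w\<close>, where the first letter of \<^term>\<open>w\<close> has position \<^term>\<open>n\<close>. The offset makes the vertex
  sets of the graphs of different factors disjoint and makes every graph occurring in the
  recursion a subgraph of the graph of the whole word. The value for words that are
  not Dyck words is irrelevant.\<close>

function dyck_graph_at :: "nat \<Rightarrow> letter list \<Rightarrow> nat sgraph" where
  "dyck_graph_at n w =
    (if w = [X, D] then ({n}, {})
     else if dyck_irreducible w then
       add_dominating n (dyck_graph_at (Suc n) (dyck_inner w))
     else if dyck w then
       (let ws = dyck_factors w;
            Gs = map (\<lambda>i. dyck_graph_at (n + length (concat (take i ws))) (ws ! i)) [0..<length ws]
        in (\<Union>G \<in> set Gs. verts G, \<Union>G \<in> set Gs. edges G))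
     else ({}, {}))"
  by auto
termination
  by (relation "measure (\<lambda>(n, w). length w)") (auto simp: length_dyck_inner length_dyck_factor)

declare dyck_graph_at.simps [simp del]

definition dyck_graph :: "letter list \<Rightarrow> nat sgraph" where
  "dyck_graph w = dyck_graph_at 0 w"

definition indep_partitions :: "letter list \<Rightarrow> nat \<Rightarrow> nat set set set" where
  "indep_partitions w k =
    {P. partition_on (verts (dyck_graph w)) P \<and> (\<forall>I \<in> P. independent_set (dyck_graph w) I) \<and> card P = k}"


section \<open>Weights\<close>

definition marked :: "nat mat \<Rightarrow> nat \<Rightarrow> nat \<Rightarrow> bool" where
  "marked M i j \<longleftrightarrow> (\<exists>i' < i. M $$ (i', j) = 1) \<or> (\<exists>j' < j. M $$ (i, j') = 1)"

definition matrix_weight :: "nat mat \<Rightarrow> nat" where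
  "matrix_weight M =
    card {(i, j). i < dim_row M \<and> j < dim_col M \<and> M $$ (i, j) = 0 \<and> \<not> marked M i j}"

definition induced_partition :: "'a set set \<Rightarrow> 'a set \<Rightarrow> 'a set set" where
  "induced_partition P V = (\<lambda>I. I \<inter> V) ` P - {{}}"

definition increasing_list :: "('a \<times> 'a) set \<Rightarrow> 'a set \<Rightarrow> 'a list" where
  "increasing_list r A = (THE xs. set xs = A \<and> distinct xs \<and> sorted_wrt (\<lambda>a b. (a, b) \<in> r) xs)"

definition merge_matrix :: "'a set set \<Rightarrow> 'a set list \<Rightarrow> 'a set list \<Rightarrow> nat mat" where
  "merge_matrix P xs ys =
    mat (length xs) (length ys) (\<lambda>(i, j). if xs ! i \<union> ys ! j \<in> P then 1 else 0)"

text \<open>The relation \<^term>\<open>r\<close> is the chosen total order on the independent sets, and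
  \<^term>\<open>P\<close> is a partition of \<^term>\<open>dyck_graph_at n w\<close>, whose dominating vertex, if \<^term>\<open>w\<close> is
  irreducible, is \<^term>\<open>n\<close>.\<close>

function partition_weight_at ::
    "(nat set \<times> nat set) set \<Rightarrow> nat \<Rightarrow> letter list \<Rightarrow> nat set set \<Rightarrow> nat" where
  "partition_weight_at r n w P =
    (if w = [X, D] then 0
     else if dyck_irreducible w then
       partition_weight_at r (Suc n) (dyck_inner w) (P - {{n}})
     else if dyck w then
       (let w\<^sub>1 = hd (dyck_factors w);
            w\<^sub>2 = concat (tl (dyck_factors w));
            n\<^sub>2 = n + length w\<^sub>1;
            P\<^sub>1 = induced_partition P (verts (dyck_graph_at n w\<^sub>1));
            P\<^sub>2 = induced_partition P (verts (dyck_graph_at n\<^sub>2 w\<^sub>2))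
        in partition_weight_at r n w\<^sub>1 P\<^sub>1 + partition_weight_at r n\<^sub>2 w\<^sub>2 P\<^sub>2
           + matrix_weight (merge_matrix P (increasing_list r P\<^sub>1) (increasing_list r P\<^sub>2)))
     else 0)"
  by auto
termination
  by (relation "measure (\<lambda>(r, n, w, P). length w)") (auto simp: length_dyck_inner length_dyck_split)

declare partition_weight_at.simps [simp del]

definition partition_weight ::
    "(nat set \<times> nat set) set \<Rightarrow> letter list \<Rightarrow> nat set set \<Rightarrow> nat" where
  "partition_weight r w P = partition_weight_at r 0 w P"

end

theory Submission
  imports Defs
begin

text \<open>
  The theorem refines to an identity in the q-deformed Weyl algebra itself: a Dyck word \<open>w\<close> equals
  $\sum_P q^{\mathrm{wt}(P)} x^{|P|} D^{|P|}$, where \<open>P\<close> runs over all partitions of $G_w$ into non-empty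
  independent sets (\<open>weyl_word_expansion\<close>). Collecting the terms with $|P| = k$ gives a normally ordered
  expansion of \<open>w\<close>, and such an expansion is unique (\<open>normal_order_unique\<close>), so its coefficients are
  the q-Stirling numbers.

  The expansion follows the recursive structure of \<open>w\<close>. If $w = x w' D$, then
  $x (x^k D^k) D = x^{k+1} D^{k+1}$ matches the fact that the dominating vertex is always a part of its own
  (\<open>sum_independent_partitions_add_dominating\<close>).

  If $w = w_1 w_2$, then the expansions of the two words multiply to a sum of terms
  $x^r D^r x^s D^s$, and the heart of the matter is to bring $D^r x^s$ into normal order. Each of the \<open>r\<close> letters
  \<open>D\<close> either cancels with one of the \<open>s\<close> letters \<open>x\<close> or passes to the right of all that remain. Recording the
  cancellations as 1's in an $r \times s$ matrix gives the sum over all placements of at most one 1 per row and column,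
  in which the power of q counts the unmarked 0's (\<open>D_power_x_power\<close>). On the side of graphs, a partition of
  a disjoint union is the same as a pair of partitions together with a matching that says which parts are united
  (\<open>sum_independent_partitions_graph_union\<close>); its matrix is such a placement, and a placement
  with \<open>m\<close> ones yields a partition into $r + s - m$ parts and the monomial $x^{r+s-m} D^{r+s-m}$
  (\<open>normal_order_merge\<close>).

  Uniqueness rests on a faithful action: \<open>x\<close> multiplies power series by the variable, and
  \<open>D\<close> is the q-derivative.
\<close>

section \<open>Normal ordering of powers in the q-deformed Weyl algebra\<close>

lemma weyl_scalar_0 [simp]: "weyl_scalar 0 = 0"
  by transfer (simp add: free_scalar_def weyl_cong_def weyl_ideal_zero)

lemma weyl_scalar_1 [simp]: "weyl_scalar 1 = 1"
  by transfer (simp add: free_scalar_def weyl_cong_def weyl_ideal_zero flip: zero_list_def)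

lemma weyl_scalar_add: "weyl_scalar (a + b) = weyl_scalar a + weyl_scalar b"
  by transfer (simp add: free_scalar_def single_add weyl_cong_def weyl_ideal_zero)

lemma weyl_scalar_mult: "weyl_scalar (a * b) = weyl_scalar a * weyl_scalar b"
  by transfer (simp add: free_scalar_def mult_single weyl_cong_def weyl_ideal_zero plus_list_def)

lemma weyl_scalar_sum: "weyl_scalar (sum f A) = (\<Sum>a\<in>A. weyl_scalar (f a))"
  by (induction A rule: infinite_finite_induct) (simp_all add: weyl_scalar_add)

lemma weyl_scalar_commute: "a * weyl_scalar c = weyl_scalar c * a"
proof transfer
  fix a c
  have "a * free_scalar c = free_scalar c * a"
    by (induction a rule: free_alg_induct)
      (simp_all add: free_scalar_def mult_single algebra_simps plus_list_def)
  then show "weyl_cong (a * free_scalar c) (free_scalar c * a)"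
    by (simp add: weyl_cong_def weyl_ideal_zero)
qed

lemma weyl_scalar_left_commute: "a * (weyl_scalar c * b) = weyl_scalar c * (a * b)"
  by (metis mult.assoc weyl_scalar_commute)

text \<open>The q-analogue $[n] = 1 + q + \cdots + q^{n-1}$ of the integer \<open>n\<close>.\<close>

definition q_int :: "nat \<Rightarrow> int poly" where
  "q_int n = (\<Sum>i<n. q_var ^ i)"

lemma q_int_0 [simp]: "q_int 0 = 0"
  by (simp add: q_int_def)

lemma q_int_Suc: "q_int (Suc n) = 1 + q_var * q_int n"
  unfolding q_int_def sum_distrib_left by (subst sum.lessThan_Suc_shift) simp

text \<open>Moving one \<^term>\<open>D\<close> to the right across \<open>n\<close> letters \<^term>\<open>X\<close>: passing a letter costs a factor q, and
  cancelling with the letter after \<open>i\<close> passes leaves weight $q^i$, which add up to $[n]$.\<close>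

lemma weyl_D_x_power:
  "weyl_D * weyl_x ^ n =
     weyl_scalar (q_var ^ n) * weyl_x ^ n * weyl_D + weyl_scalar (q_int n) * weyl_x ^ (n - 1)"
proof (induction n)
  case 0
  then show ?case by simp
next
  case (Suc n)
  have x: "weyl_scalar (q_int n) * (weyl_x * weyl_x ^ (n - 1)) = weyl_scalar (q_int n) * weyl_x ^ n"
    by (cases n) simp_all
  have x_D: "weyl_x * (weyl_D * weyl_x ^ n)
      = weyl_scalar (q_var ^ n) * (weyl_x ^ Suc n * weyl_D) + weyl_scalar (q_int n) * weyl_x ^ n"
    unfolding Suc distrib_left weyl_scalar_left_commute[of weyl_x] mult.assoc x
    by (simp add: mult.assoc)
  have "weyl_D * weyl_x ^ Suc n = (weyl_scalar q_var * weyl_x * weyl_D + 1) * weyl_x ^ n"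
    unfolding weyl_relation[symmetric] by (simp add: mult.assoc)
  also have "\<dots> = weyl_scalar q_var * (weyl_x * (weyl_D * weyl_x ^ n)) + weyl_x ^ n"
    by (simp add: algebra_simps)
  also have "\<dots> = weyl_scalar q_var * (weyl_scalar (q_var ^ n) * (weyl_x ^ Suc n * weyl_D)
      + weyl_scalar (q_int n) * weyl_x ^ n) + weyl_x ^ n"
    by (simp only: x_D)
  also have "\<dots> = weyl_scalar (q_var ^ Suc n) * weyl_x ^ Suc n * weyl_D
      + weyl_scalar (q_int (Suc n)) * weyl_x ^ n"
    by (simp only: q_int_Suc weyl_scalar_mult weyl_scalar_add power_Suc distrib_left distrib_right mult.assoc weyl_scalar_1)
       (simp add: algebra_simps)
  finally show ?case by simp
qed

text \<open>The ranks of the elements of \<open>C\<close> are exactly $0, \ldots, |C| - 1$. This turns the coefficient $[|C|]$ of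
  the commutation rule into a sum over the column in which a row has its 1.\<close>

lemma sum_q_var_rank:
  fixes C :: "'a::linorder set"
  assumes "finite C"
  shows "(\<Sum>j\<in>C. q_var ^ card {j'\<in>C. j' < j}) = q_int (card C)"
  using assms
proof (induction rule: finite_linorder_max_induct)
  case empty
  then show ?case by simp
next
  case (insert b C)
  have "{j' \<in> insert b C. j' < b} = C"
    using insert.hyps by auto
  moreover have "{j' \<in> insert b C. j' < j} = {j' \<in> C. j' < j}" if "j \<in> C" for j
    using insert.hyps that by auto
  moreover have "b \<notin> C"
    using insert.hyps by auto
  ultimately show ?case
    using insert by (simp add: q_int_def add.commute)
qed

text \<open>Read as a set of positions of 1's, a matching is a 0/1 matrix with at most one 1 in each row and
  column. The rows and columns form arbitrary sets, so that a row or a column can be deleted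
  without renumbering, and the same notion describes which parts of two partitions are merged.\<close>

definition matchings :: "'a set \<Rightarrow> 'b set \<Rightarrow> ('a \<times> 'b) set set" where
  "matchings A C = {R. R \<subseteq> A \<times> C \<and> single_valued R \<and> single_valued (R\<inverse>)}"

text \<open>The unmarked 0's. The comparisons are non-strict: the case of equality says that the entry is itself
  not a 1.\<close>

definition free_cells :: "'a::linorder set \<Rightarrow> 'b::linorder set \<Rightarrow> ('a \<times> 'b) set \<Rightarrow> ('a \<times> 'b) set" where
  "free_cells A C R =
     {(i, j). i \<in> A \<and> j \<in> C \<and> (\<forall>i'\<le>i. (i', j) \<notin> R) \<and> (\<forall>j'\<le>j. (i, j') \<notin> R)}"

lemma finite_matchings: "finite A \<Longrightarrow> finite C \<Longrightarrow> finite (matchings A C)"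
  by (rule finite_subset[of _ "Pow (A \<times> C)"]) (auto simp: matchings_def)

lemma card_matching:
  assumes "R \<in> matchings A C" "finite A" "finite C"
  shows "finite R" "card R = card (Domain R)" "card R = card (Range R)" "card R \<le> card A" "card R \<le> card C"
proof -
  show f: "finite R"
    using assms by (auto simp: matchings_def intro: finite_subset)
  have "inj_on fst R" "inj_on snd R"
    using assms(1) by (auto simp: matchings_def inj_on_def single_valued_def)
  then show 1: "card R = card (Domain R)" and 2: "card R = card (Range R)"
    by (simp_all add: card_image Domain_fst Range_snd)
  show "card R \<le> card A"
    unfolding 1 using assms by (auto simp: matchings_def intro!: card_mono)
  show "card R \<le> card C"
    unfolding 2 using assms by (auto simp: matchings_def intro!: card_mono)
qed

lemma matchings_insert_left:
  assumes "b \<notin> A"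
  shows "matchings (insert b A) C =
    matchings A C \<union> (\<Union>j\<in>C. insert (b, j) ` matchings A (C - {j}))"
proof (intro equalityI subsetI)
  fix R assume R: "R \<in> matchings (insert b A) C"
  show "R \<in> matchings A C \<union> (\<Union>j\<in>C. insert (b, j) ` matchings A (C - {j}))"
  proof (cases "b \<in> Domain R")
    case False
    then have "R \<in> matchings A C" using R by (auto simp: matchings_def)
    then show ?thesis by blast
  next
    case True
    then obtain j where j: "(b, j) \<in> R" by blast
    have "R - {(b, j)} \<in> matchings A (C - {j})"
      using R j by (auto simp: matchings_def single_valued_def)
    moreover have "R = insert (b, j) (R - {(b, j)})" "j \<in> C"
      using R j by (auto simp: matchings_def)
    ultimately show ?thesis by blast
  qed
next
  fix R assume "R \<in> matchings A C \<union> (\<Union>j\<in>C. insert (b, j) ` matchings A (C - {j}))"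
  then show "R \<in> matchings (insert b A) C"
    using assms by (auto simp: matchings_def single_valued_def)
qed

text \<open>Case distinction on the row \<open>b\<close>: it is empty, or it has its 1 in some column \<open>j\<close>, which is then
  unavailable to the other rows.\<close>

lemma sum_matchings_insert_left:
  fixes A :: "'a set" and C :: "'b set"
  assumes "b \<notin> A" "finite A" "finite C"
  shows "(\<Sum>R\<in>matchings (insert b A) C. F R) =
    (\<Sum>R\<in>matchings A C. F R) + (\<Sum>j\<in>C. \<Sum>R\<in>matchings A (C - {j}). F (insert (b, j) R))"
proof -
  let ?U = "\<lambda>j. insert (b, j) ` matchings A (C - {j})"
  have nb: "(b, j) \<notin> R" if "R \<in> matchings A C'" for R j and C' :: "'b set"
    using that assms(1) by (auto simp: matchings_def)
  have "matchings A C \<inter> (\<Union>j\<in>C. ?U j) = {}"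
    using nb by fastforce
  moreover have "?U j \<inter> ?U j' = {}" if "j \<noteq> j'" for j j'
  proof -
    have "insert (b, j) R \<noteq> insert (b, j') R'" if "R' \<in> matchings A (C - {j'})" for R R'
      using nb[OF that, of j] \<open>j \<noteq> j'\<close> by blast
    then show ?thesis
      by blast
  qed
  moreover have "inj_on (insert (b, j)) (matchings A (C - {j}))" for j
    using nb by (meson inj_onI insert_ident)
  ultimately show ?thesis
    using assms unfolding matchings_insert_left[OF assms(1)]
    by (subst sum.union_disjoint) (simp_all add: finite_matchings sum.UNION_disjoint sum.reindex)
qed

text \<open>A topmost row without a 1 consists of unmarked 0's only and marks nothing below it.\<close>

lemma free_cells_insert_min_unmatched:
  assumes "R \<subseteq> A \<times> C" "\<forall>a\<in>A. b < a"
  shows "free_cells (insert b A) C R = {b} \<times> C \<union> free_cells A C R"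
proof -
  have "(b, j) \<notin> R" "\<forall>i'\<le>b. (i', j) \<notin> R" for j
    using assms by (auto dest: leD)
  then show ?thesis
    unfolding free_cells_def by auto
qed

text \<open>A topmost row with its 1 in column \<open>j\<close> contributes the cells to the left of \<open>j\<close>; everything to the
  right is marked, and so is the rest of column \<open>j\<close>.\<close>

lemma free_cells_insert_min_matched:
  assumes "R \<subseteq> A \<times> (C - {j})" "\<forall>a\<in>A. b < a" "j \<in> C"
  shows "free_cells (insert b A) C (insert (b, j) R)
    = {b} \<times> {j'\<in>C. j' < j} \<union> free_cells A (C - {j}) R"
proof -
  have 1: "\<forall>i'\<le>b. (i', l) \<notin> R" "(b, l) \<notin> R" "(i', j) \<notin> R" for l i'
    using assms by (auto dest: leD)
  have 2: "i \<noteq> b" "(\<forall>i'\<le>i. i' \<noteq> b) = False" if "i \<in> A" for i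
    using assms that by auto
  have "(i, l) \<in> free_cells (insert b A) C (insert (b, j) R)
      \<longleftrightarrow> (i, l) \<in> {b} \<times> {j'\<in>C. j' < j} \<union> free_cells A (C - {j}) R" for i l
  proof (cases "i = b")
    case True
    then show ?thesis
      using 1 2 assms by (auto simp: free_cells_def not_le)
  next
    case False
    have "(\<forall>i'\<le>i. (i', l) \<notin> insert (b, j) R) \<longleftrightarrow> l \<noteq> j \<and> (\<forall>i'\<le>i. (i', l) \<notin> R)" if "i \<in> A"
      using 2[OF that] by auto
    then show ?thesis
      using False by (auto simp: free_cells_def)
  qed
  then show ?thesis
    by auto
qed

text \<open>Each of the \<^term>\<open>card A\<close> letters \<^term>\<open>D\<close> is a row and each of the \<^term>\<open>card C\<close> letters \<^term>\<open>X\<close> a column; a 1 in a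
  cell records that the two letters cancel. The \<^term>\<open>D\<close> next to the \<^term>\<open>X\<close>'s is the topmost row: it either
  passes all columns, with weight $q^{|C|}$, or cancels with column \<open>j\<close>, with weight q to the number of
  columns left of \<open>j\<close>. These weights count the unmarked 0's of that row, and the
  remaining letters form the matrix without that row, and without column \<open>j\<close> in the second case.\<close>

lemma D_power_x_power:
  fixes A :: "'a::linorder set" and C :: "'b::linorder set"
  assumes "finite A" "finite C"
  shows "weyl_D ^ card A * weyl_x ^ card C =
    (\<Sum>R\<in>matchings A C. weyl_scalar (q_var ^ card (free_cells A C R))
       * weyl_x ^ (card C - card R) * weyl_D ^ (card A - card R))"
  using assms
proof (induction A arbitrary: C rule: finite_linorder_min_induct)
  case empty
  have "matchings ({} :: 'a set) C = {{}}"
    by (auto simp: matchings_def)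
  then show ?case by (simp add: free_cells_def)
next
  case (insert b A)
  have b: "b \<notin> A" using insert.hyps by auto
  define T where "T A C R = weyl_scalar (q_var ^ card (free_cells A C R))
       * weyl_x ^ (card C - card R) * weyl_D ^ (card A - card R)"
    for A :: "'a set" and C :: "'b set" and R
  have IH: "weyl_D ^ card A * weyl_x ^ card C = (\<Sum>R\<in>matchings A C. T A C R)" if "finite C" for C :: "'b set"
    using insert.IH[OF that] by (simp add: T_def)
  \<comment> \<open>The topmost row is empty.\<close>
  have none: "T (insert b A) C R = weyl_scalar (q_var ^ card C) * T A C R * weyl_D"
    if R: "R \<in> matchings A C" for R
  proof -
    have "free_cells (insert b A) C R = {b} \<times> C \<union> free_cells A C R"
      using R insert.hyps by (intro free_cells_insert_min_unmatched) (auto simp: matchings_def)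
    moreover have "finite (free_cells A C R)"
      using insert by (auto simp: free_cells_def intro: finite_subset[of _ "A \<times> C"])
    moreover have "({b} \<times> C) \<inter> free_cells A C R = {}"
      using b by (auto simp: free_cells_def)
    ultimately have "card (free_cells (insert b A) C R) = card C + card (free_cells A C R)"
      using insert.prems by (simp add: card_Un_disjoint)
    moreover have "Suc (card A) - card R = Suc (card A - card R)"
      using card_matching(4)[OF R] insert by (simp add: Suc_diff_le)
    ultimately show ?thesis
      using insert.hyps b
      by (simp only: T_def card_insert_disjoint power_add weyl_scalar_mult mult.assoc power_Suc2 simp_thms)
  qed
  \<comment> \<open>The topmost row has its 1 in column \<open>j\<close>.\<close>
  have one: "T (insert b A) C (insert (b, j) R)
      = weyl_scalar (q_var ^ card {j'\<in>C. j' < j}) * T A (C - {j}) R"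
    if R: "R \<in> matchings A (C - {j})" and j: "j \<in> C" for R j
  proof -
    have "free_cells (insert b A) C (insert (b, j) R) =
        {b} \<times> {j'\<in>C. j' < j} \<union> free_cells A (C - {j}) R"
      using R j insert.hyps by (intro free_cells_insert_min_matched) (auto simp: matchings_def)
    moreover have "finite (free_cells A (C - {j}) R)"
      using insert by (auto simp: free_cells_def intro: finite_subset[of _ "A \<times> C"])
    moreover have "({b} \<times> {j'\<in>C. j' < j}) \<inter> free_cells A (C - {j}) R = {}"
      using b by (auto simp: free_cells_def)
    ultimately have "card (free_cells (insert b A) C (insert (b, j) R))
        = card {j'\<in>C. j' < j} + card (free_cells A (C - {j}) R)"
      using insert.prems by (simp add: card_Un_disjoint card_cartesian_product_singleton)
    moreover have "card (insert (b, j) R) = Suc (card R)"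
      using R b card_matching(1)[OF R] insert by (subst card_insert_disjoint) (auto simp: matchings_def)
    ultimately show ?thesis
      using insert.hyps b j insert.prems
      by (simp add: T_def power_add weyl_scalar_mult mult.assoc card_Diff_singleton)
  qed
  have "weyl_D ^ card (insert b A) * weyl_x ^ card C = weyl_D ^ card A * (weyl_D * weyl_x ^ card C)"
    using insert.hyps b by (simp only: card_insert_disjoint simp_thms power_Suc2 mult.assoc)
  also have "\<dots> = weyl_scalar (q_var ^ card C) * (weyl_D ^ card A * weyl_x ^ card C) * weyl_D
      + weyl_scalar (q_int (card C)) * (weyl_D ^ card A * weyl_x ^ (card C - 1))"
    unfolding weyl_D_x_power distrib_left mult.assoc weyl_scalar_left_commute[of "weyl_D ^ _"] ..
  also have "weyl_scalar (q_var ^ card C) * (weyl_D ^ card A * weyl_x ^ card C) * weyl_D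
      = (\<Sum>R\<in>matchings A C. T (insert b A) C R)"
    unfolding IH[OF insert.prems] by (simp add: sum_distrib_left sum_distrib_right none)
  also have "weyl_scalar (q_int (card C)) * (weyl_D ^ card A * weyl_x ^ (card C - 1))
      = (\<Sum>j\<in>C. weyl_scalar (q_var ^ card {j'\<in>C. j' < j}) * (weyl_D ^ card A * weyl_x ^ card (C - {j})))"
    using insert.prems
    by (simp add: weyl_scalar_sum sum_distrib_right flip: sum_q_var_rank)
  also have "\<dots> = (\<Sum>j\<in>C. \<Sum>R\<in>matchings A (C - {j}). T (insert b A) C (insert (b, j) R))"
    by (simp only: IH[OF finite_Diff[OF insert.prems]] sum_distrib_left one mult.assoc cong: sum.cong)
  finally show ?case
    unfolding T_def[symmetric]
    by (subst sum_matchings_insert_left[OF b insert.hyps(1) insert.prems])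
qed

section \<open>Uniqueness of normally ordered expansions\<close>

text \<open>A function \<^term>\<open>f :: nat \<Rightarrow> int poly\<close> stands for the power series $\sum_n f(n) t^n$, on which \<^term>\<open>X\<close>
  acts as multiplication by \<open>t\<close> and \<^term>\<open>D\<close> as the q-derivative $t^{n+1} \mapsto [n+1] t^n$. The defining
  relation of the algebra holds because $[n+1] = 1 + q[n]$.\<close>

fun letter_act :: "letter \<Rightarrow> (nat \<Rightarrow> int poly) \<Rightarrow> nat \<Rightarrow> int poly" where
  "letter_act X f n = (if n = 0 then 0 else f (n - 1))"
| "letter_act D f n = q_int (Suc n) * f (Suc n)"

definition word_act :: "letter list \<Rightarrow> (nat \<Rightarrow> int poly) \<Rightarrow> nat \<Rightarrow> int poly" where
  "word_act w f = foldr letter_act w f"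

lemma word_act_append: "word_act (u @ v) f = word_act u (word_act v f)"
  by (simp add: word_act_def)

lemma letter_act_add: "letter_act l (\<lambda>n. f n + g n) = (\<lambda>n. letter_act l f n + letter_act l g n)"
  by (cases l) (auto simp: algebra_simps)

lemma letter_act_smult: "letter_act l (\<lambda>n. c * f n) = (\<lambda>n. c * letter_act l f n)"
  by (cases l) (auto simp: algebra_simps)

lemma word_act_add: "word_act w (\<lambda>n. f n + g n) = (\<lambda>n. word_act w f n + word_act w g n)"
  by (induction w) (simp_all add: word_act_def letter_act_add)

lemma word_act_smult: "word_act w (\<lambda>n. c * f n) = (\<lambda>n. c * word_act w f n)"
  by (induction w) (simp_all add: word_act_def letter_act_smult)

text \<open>The linear extension of \<^const>\<open>word_act\<close> to the free algebra. It annihilates \<^const>\<open>weyl_ideal\<close> and hence descends to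
  the q-deformed Weyl algebra.\<close>

definition free_act :: "free_alg \<Rightarrow> (nat \<Rightarrow> int poly) \<Rightarrow> nat \<Rightarrow> int poly" where
  "free_act a f n = (\<Sum>w. Poly_Mapping.lookup a w * word_act w f n)"

lemma free_act_add: "free_act (a + b) f n = free_act a f n + free_act b f n"
proof -
  have "finite {w. Poly_Mapping.lookup c w * word_act w f n \<noteq> 0}" for c :: free_alg
    by (rule finite_subset[OF _ finite_lookup[of c]]) auto
  then show ?thesis
    unfolding free_act_def by (simp add: lookup_add distrib_right Sum_any.distrib)
qed

lemma free_act_single: "free_act (Poly_Mapping.single w c) f n = c * word_act w f n"
  unfolding free_act_def lookup_single by (simp add: when_def if_distrib[of "\<lambda>p. p * _"] cong: if_cong)

lemma free_act_mult: "free_act (a * b) f n = free_act a (free_act b f) n"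
proof (induction a arbitrary: n rule: free_alg_induct)
  case (single w c)
  show ?case
  proof (induction b arbitrary: n rule: free_alg_induct)
    case (single v d)
    have "free_act (Poly_Mapping.single v d) f = (\<lambda>n. d * word_act v f n)"
      by (simp add: fun_eq_iff free_act_single)
    then show ?case
      by (simp add: mult_single free_act_single plus_list_def word_act_append word_act_smult)
  next
    case (add a b)
    have "free_act (a + b) f = (\<lambda>n. free_act a f n + free_act b f n)"
      by (simp add: fun_eq_iff free_act_add)
    then show ?case
      using add by (simp add: distrib_left free_act_add free_act_single word_act_add)
  qed
qed (simp add: free_act_add distrib_right)

lemma free_act_uminus: "free_act (- a) f n = - free_act a f n"
  using free_act_add[of a "- a" f n] free_act_single[of 0 0 f n]
  by (simp add: eq_neg_iff_add_eq_0 add.commute)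

lemma free_act_diff: "free_act (a - b) f n = free_act a f n - free_act b f n"
  by (simp only: diff_conv_add_uminus free_act_add free_act_uminus)

lemma free_act_1: "free_act 1 f n = f n"
proof -
  have "word_act 0 f n = f n"
    by (simp add: zero_list_def word_act_def)
  then show ?thesis
    using free_act_single[of 0 1 f n] by simp
qed

lemma free_act_zero: "free_act a (\<lambda>_. 0) n = 0"
proof (induction a rule: free_alg_induct)
  case (single w c)
  then show ?case using word_act_smult[of w 0] by (simp add: free_act_single fun_eq_iff)
qed (simp add: free_act_add)

lemma free_act_weyl_ideal: "a \<in> weyl_ideal \<Longrightarrow> free_act a f n = 0"
proof (induction arbitrary: f n rule: weyl_ideal.induct)
  case relation
  show ?case
    by (simp add: free_act_diff free_act_add free_act_mult free_act_1)
      (simp add: free_word_def free_scalar_def free_act_single word_act_def q_int_Suc algebra_simps)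
next
  case (mult_left a c)
  have "free_act a f = (\<lambda>_. 0)" for f using mult_left by auto
  then show ?case by (simp add: free_act_mult free_act_zero)
qed (simp_all add: free_act_add free_act_mult)

lift_definition weyl_act :: "q_weyl \<Rightarrow> (nat \<Rightarrow> int poly) \<Rightarrow> nat \<Rightarrow> int poly" is free_act
proof (intro ext)
  fix a b f n assume "weyl_cong a b"
  then show "free_act a f n = free_act b f n"
    unfolding weyl_cong_def using free_act_weyl_ideal[of "a - b" f n] by (simp add: free_act_diff)
qed

lemma weyl_act_mult: "weyl_act (a * b) f = weyl_act a (weyl_act b f)"
  by transfer (simp add: fun_eq_iff free_act_mult)

lemma weyl_act_1: "weyl_act 1 f = f"
  by transfer (simp add: fun_eq_iff free_act_1)

lemma weyl_act_add: "weyl_act (a + b) f n = weyl_act a f n + weyl_act b f n"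
  by transfer (simp add: free_act_add)

lemma weyl_act_0: "weyl_act 0 f n = 0"
  using weyl_act_add[of 0 0 f n] by simp

lemma weyl_act_sum: "weyl_act (sum g A) f n = (\<Sum>a\<in>A. weyl_act (g a) f n)"
  by (induction A rule: infinite_finite_induct) (simp_all add: weyl_act_0 weyl_act_add)

lemma weyl_act_scalar: "weyl_act (weyl_scalar c) f n = c * f n"
  by transfer (simp add: free_scalar_def free_act_single word_act_def)

lemma weyl_act_x: "weyl_act weyl_x f n = (if n = 0 then 0 else f (n - 1))"
  by transfer (simp add: free_word_def free_act_single word_act_def)

lemma weyl_act_D: "weyl_act weyl_D f n = q_int (Suc n) * f (Suc n)"
  by transfer (simp add: free_word_def free_act_single word_act_def)

lemma weyl_act_x_power: "weyl_act (weyl_x ^ k) f n = (if n < k then 0 else f (n - k))"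
  by (induction k arbitrary: n) (auto simp: weyl_act_1 weyl_act_mult weyl_act_x)

lemma weyl_act_D_power: "weyl_act (weyl_D ^ k) (\<lambda>_. 1) n = (\<Prod>i<k. q_int (Suc (n + i)))"
proof (induction k arbitrary: n)
  case (Suc k)
  then show ?case
    by (simp add: weyl_act_mult weyl_act_D prod.lessThan_Suc_shift del: prod.lessThan_Suc)
qed (simp add: weyl_act_1)

lemma q_int_Suc_neq_0: "q_int (Suc n) \<noteq> 0"
proof
  assume "q_int (Suc n) = 0"
  then have "poly (q_int (Suc n)) 0 = 0" by simp
  then show False by (simp add: q_int_Suc q_var_def)
qed

text \<open>Apply both sides to the series with all coefficients 1. The coefficient of $t^n$ in the image under
  $x^k D^k$ is $[n][n-1]\cdots[n-k+1]$, which vanishes for $k > n$ and not for $k = n$. The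
  system of equations for the coefficients \<^term>\<open>S k\<close> is thus triangular with non-zero diagonal over an integral
  domain.\<close>

lemma normal_order_unique:
  fixes S T :: "nat \<Rightarrow> int poly"
  assumes "finite K" "finite L" "\<And>k. k \<notin> K \<Longrightarrow> S k = 0" "\<And>k. k \<notin> L \<Longrightarrow> T k = 0"
    and eq: "(\<Sum>k\<in>K. weyl_scalar (S k) * weyl_x ^ k * weyl_D ^ k) =
      (\<Sum>k\<in>L. weyl_scalar (T k) * weyl_x ^ k * weyl_D ^ k)"
  shows "S = T"
proof
  define e where "e n k = weyl_act (weyl_x ^ k) (weyl_act (weyl_D ^ k) (\<lambda>_. 1)) n" for n k
  have e0: "e n k = 0" if "n < k" for n k
    using that by (simp add: e_def weyl_act_x_power)
  have e1: "e n n \<noteq> 0" for n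
    by (simp add: e_def weyl_act_x_power weyl_act_D_power q_int_Suc_neq_0)
  have val: "weyl_act (\<Sum>k\<in>K. weyl_scalar (S k) * weyl_x ^ k * weyl_D ^ k) (\<lambda>_. 1) n
      = (\<Sum>k\<le>n. S k * e n k)" if "finite K" "\<And>k. k \<notin> K \<Longrightarrow> S k = 0" for K S n
  proof -
    have "(\<Sum>k\<in>K. S k * e n k) = (\<Sum>k\<le>n. S k * e n k)"
      using that by (intro sum.mono_neutral_cong) (auto simp: not_le e0)
    then show ?thesis
      by (simp add: weyl_act_sum weyl_act_mult weyl_act_scalar mult.assoc flip: e_def)
  qed
  have eqs: "(\<Sum>k\<le>n. S k * e n k) = (\<Sum>k\<le>n. T k * e n k)" for n
    using arg_cong[OF eq, of "\<lambda>a. weyl_act a (\<lambda>_. 1) n"] by (simp add: val[OF assms(1,3)] val[OF assms(2,4)])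
  show "S n = T n" for n
  proof (induction n rule: less_induct)
    case (less n)
    then have "(\<Sum>k<n. S k * e n k) = (\<Sum>k<n. T k * e n k)"
      by simp
    then have "S n * e n n = T n * e n n"
      using eqs[of n] by (simp add: lessThan_Suc_atMost[symmetric])
    then show ?case using e1 by simp
  qed
qed



section \<open>Matchings and matrix weights\<close>

lemma bij_betw_matchings:
  assumes f: "bij_betw f A A'" and g: "bij_betw g C C'"
  shows "bij_betw (image (map_prod f g)) (matchings A C) (matchings A' C')"
proof -
  have inj: "inj_on (map_prod f g) (A \<times> C)"
    using f g by (auto simp: bij_betw_def intro: map_prod_inj_on)
  have sub: "matchings A C \<subseteq> Pow (A \<times> C)"
    by (auto simp: matchings_def)
  have img: "map_prod f g ` R \<in> matchings A' C' \<longleftrightarrow> R \<in> matchings A C" if R: "R \<subseteq> A \<times> C" for R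
  proof -
    have f1: "f a \<in> A'" if "a \<in> A" for a
      using f that by (auto simp: bij_betw_def)
    have g1: "g c \<in> C'" if "c \<in> C" for c
      using g that by (auto simp: bij_betw_def)
    have f2: "f a = f a' \<longleftrightarrow> a = a'" if "(a, c) \<in> R" "(a', c') \<in> R" for a a' c c'
      using f R that by (auto simp: bij_betw_def inj_on_def)
    have g2: "g c = g c' \<longleftrightarrow> c = c'" if "(a, c) \<in> R" "(a', c') \<in> R" for a a' c c'
      using g R that by (auto simp: bij_betw_def inj_on_def)
    have "map_prod f g ` R \<subseteq> A' \<times> C'"
      using R f1 g1 by auto
    moreover have "single_valued (map_prod f g ` R) \<longleftrightarrow> single_valued R"
      unfolding single_valued_def by (force simp: f2 g2)
    moreover have "single_valued ((map_prod f g ` R)\<inverse>) \<longleftrightarrow> single_valued (R\<inverse>)"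
      unfolding single_valued_def by (force simp: f2 g2)
    ultimately show ?thesis
      using R by (simp add: matchings_def)
  qed
  have surj: "\<exists>R. R \<subseteq> A \<times> C \<and> T = map_prod f g ` R" if "T \<in> matchings A' C'" for T
  proof -
    have "T \<subseteq> map_prod f g ` (A \<times> C)"
      using that f g by (auto simp: matchings_def bij_betw_def map_prod_surj_on)
    then show ?thesis
      by (simp only: subset_image_iff)
  qed
  show ?thesis
    unfolding bij_betw_def
  proof (intro conjI equalityI subsetI)
    show "inj_on (image (map_prod f g)) (matchings A C)"
      using inj_on_image_Pow[OF inj] sub by (rule inj_on_subset)
  next
    fix T assume "T \<in> image (map_prod f g) ` matchings A C"
    then show "T \<in> matchings A' C'"
      using img sub by auto
  next
    fix T assume T: "T \<in> matchings A' C'"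
    then obtain R where "R \<subseteq> A \<times> C" "T = map_prod f g ` R"
      using surj by blast
    then show "T \<in> image (map_prod f g) ` matchings A C"
      using img T by blast
  qed
qed

text \<open>The weight of a matrix counts its unmarked 0's, as \<^const>\<open>free_cells\<close> does for the set of positions of its
  1's.\<close>

lemma matrix_weight_eq_card_free_cells:
  assumes "R \<subseteq> {..<dim_row M} \<times> {..<dim_col M}"
    and "\<And>i j. i < dim_row M \<Longrightarrow> j < dim_col M \<Longrightarrow> M $$ (i, j) = (if (i, j) \<in> R then 1 else 0)"
  shows "matrix_weight M = card (free_cells {..<dim_row M} {..<dim_col M} R)"
proof -
  have "M $$ (i, j) = 0 \<and> \<not> marked M i j \<longleftrightarrow> (\<forall>i'\<le>i. (i', j) \<notin> R) \<and> (\<forall>j'\<le>j. (i, j') \<notin> R)"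
    if "i < dim_row M" "j < dim_col M" for i j
    using that assms(2) unfolding marked_def by (auto simp: le_less)
  then show ?thesis
    unfolding matrix_weight_def free_cells_def by (intro arg_cong[of _ _ card]) auto
qed

section \<open>Partitions of a disjoint union\<close>

text \<open>The partition obtained from partitions \<open>P\<close> and \<open>Q\<close> of disjoint sets by uniting the pairs in \<open>T\<close> and keeping
  all other parts; \<open>split_pairs\<close> below recovers \<open>T\<close>.\<close>

definition merge_along :: "('a set \<times> 'a set) set \<Rightarrow> 'a set set \<Rightarrow> 'a set set \<Rightarrow> 'a set set" where
  "merge_along T P Q = (\<lambda>(A, B). A \<union> B) ` T \<union> (P - Domain T) \<union> (Q - Range T)"

definition split_pairs :: "'a set set \<Rightarrow> 'a set set \<Rightarrow> 'a set set \<Rightarrow> ('a set \<times> 'a set) set" where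
  "split_pairs R P Q = {(A, B). A \<in> P \<and> B \<in> Q \<and> A \<union> B \<in> R}"

lemma partition_on_part: "partition_on V P \<Longrightarrow> A \<in> P \<Longrightarrow> A \<subseteq> V \<and> A \<noteq> {}"
  by (auto simp: partition_on_def)

lemma partition_on_eqI: "partition_on V P \<Longrightarrow> A \<in> P \<Longrightarrow> B \<in> P \<Longrightarrow> x \<in> A \<Longrightarrow> x \<in> B \<Longrightarrow> A = B"
  by (auto simp: partition_on_def disjoint_def)

lemma partition_on_induced:
  assumes "partition_on W P" "V \<subseteq> W"
  shows "partition_on V (induced_partition P V)"
proof -
  have "(\<inter>) V = (\<lambda>I. I \<inter> V)"
    by (auto simp: fun_eq_iff)
  then show ?thesis
    using partition_on_restrict[OF assms(1), of V] assms(2)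
    by (simp add: induced_partition_def Int_absorb1)
qed

lemma induced_partition_eqI:
  assumes "\<And>p. p \<in> R \<Longrightarrow> p \<inter> V \<in> insert {} P"
    and "\<And>A. A \<in> P \<Longrightarrow> \<exists>p\<in>R. p \<inter> V = A" and "{} \<notin> P"
  shows "induced_partition R V = P"
proof (intro equalityI subsetI)
  fix A assume "A \<in> P"
  then obtain p where "p \<in> R" "p \<inter> V = A" using assms(2) by blast
  moreover have "A \<noteq> {}" using \<open>A \<in> P\<close> assms(3) by blast
  ultimately show "A \<in> induced_partition R V"
    unfolding induced_partition_def by blast
qed (use assms(1) in \<open>auto simp: induced_partition_def\<close>)

context
  fixes V W :: "'a set" and P Q :: "'a set set"
  assumes P: "partition_on V P" and Q: "partition_on W Q" and VW: "V \<inter> W = {}"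
begin

lemma union_parts_Int:
  assumes "A \<in> P" "B \<in> Q"
  shows "(A \<union> B) \<inter> V = A" "(A \<union> B) \<inter> W = B"
  using partition_on_part[OF P assms(1)] partition_on_part[OF Q assms(2)] VW by auto

lemma left_part_Int: "A \<in> P \<Longrightarrow> A \<inter> V = A \<and> A \<inter> W = {}"
  using partition_on_part[OF P] VW by blast

lemma right_part_Int: "B \<in> Q \<Longrightarrow> B \<inter> W = B \<and> B \<inter> V = {}"
  using partition_on_part[OF Q] VW by blast

lemma merge_along_cases:
  assumes "T \<in> matchings P Q" "p \<in> merge_along T P Q"
  obtains (both) A B where "(A, B) \<in> T" "A \<in> P" "B \<in> Q" "p = A \<union> B" "p \<inter> V = A" "p \<inter> W = B"
  | (left) "p \<in> P" "p \<notin> Domain T" "p \<inter> V = p" "p \<inter> W = {}"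
  | (right) "p \<in> Q" "p \<notin> Range T" "p \<inter> V = {}" "p \<inter> W = p"
proof -
  consider A B where "(A, B) \<in> T" "p = A \<union> B" | "p \<in> P" "p \<notin> Domain T" | "p \<in> Q" "p \<notin> Range T"
    using assms(2) by (auto simp: merge_along_def)
  then show ?thesis
  proof cases
    case 1
    then have "A \<in> P" "B \<in> Q" using assms(1) by (auto simp: matchings_def)
    then show ?thesis using 1 union_parts_Int both by simp
  next
    case 2
    then show ?thesis using left_part_Int left by simp
  next
    case 3
    then show ?thesis using right_part_Int right by simp
  qed
qed

text \<open>A part of the merged partition is determined by either of its non-empty traces, because a part of \<open>P\<close>
  is matched with at most one part of \<open>Q\<close> and vice versa.\<close>

lemma merge_along_trace_inj:
  assumes T: "T \<in> matchings P Q" and p: "p \<in> merge_along T P Q" and q: "q \<in> merge_along T P Q"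
  shows "p \<inter> V = q \<inter> V \<Longrightarrow> p \<inter> V \<noteq> {} \<Longrightarrow> p = q"
    and "p \<inter> W = q \<inter> W \<Longrightarrow> p \<inter> W \<noteq> {} \<Longrightarrow> p = q"
proof -
  have sv: "(A, B) \<in> T \<Longrightarrow> (A, B') \<in> T \<Longrightarrow> B = B'" "(A, B) \<in> T \<Longrightarrow> (A', B) \<in> T \<Longrightarrow> A = A'" for A A' B B'
    using T by (auto simp: matchings_def single_valued_def)
  have left: "(\<exists>B. (s \<inter> V, B) \<in> T \<and> s = (s \<inter> V) \<union> B) \<or> s \<inter> V \<notin> Domain T \<and> s = s \<inter> V"
    if s: "s \<in> merge_along T P Q" and "s \<inter> V \<noteq> {}" for s
    using s by (cases rule: merge_along_cases[OF T]) (use that in auto)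
  have right: "(\<exists>A. (A, s \<inter> W) \<in> T \<and> s = A \<union> (s \<inter> W)) \<or> s \<inter> W \<notin> Range T \<and> s = s \<inter> W"
    if s: "s \<in> merge_along T P Q" and "s \<inter> W \<noteq> {}" for s
    using s by (cases rule: merge_along_cases[OF T]) (use that in auto)
  show "p = q" if "p \<inter> V = q \<inter> V" "p \<inter> V \<noteq> {}"
    using left[OF p] left[OF q] that sv(1) by (metis Domain.DomainI)
  show "p = q" if "p \<inter> W = q \<inter> W" "p \<inter> W \<noteq> {}"
    using right[OF p] right[OF q] that sv(2) by (metis Range.intros)
qed

lemma union_in_merge_along: "(A, B) \<in> T \<Longrightarrow> A \<union> B \<in> merge_along T P Q"
  unfolding merge_along_def by (auto intro: rev_image_eqI)

lemma merge_along_cover: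
  shows "A \<in> P \<Longrightarrow> \<exists>p\<in>merge_along T P Q. A \<subseteq> p"
    and "B \<in> Q \<Longrightarrow> \<exists>p\<in>merge_along T P Q. B \<subseteq> p"
proof -
  show "\<exists>p\<in>merge_along T P Q. A \<subseteq> p" if "A \<in> P"
  proof (cases "A \<in> Domain T")
    case True
    then obtain B where "(A, B) \<in> T" by blast
    then show ?thesis using union_in_merge_along by (intro bexI[of _ "A \<union> B"]) auto
  next
    case False
    then show ?thesis using that by (intro bexI[of _ A]) (simp_all add: merge_along_def)
  qed
  show "\<exists>p\<in>merge_along T P Q. B \<subseteq> p" if "B \<in> Q"
  proof (cases "B \<in> Range T")
    case True
    then obtain A where "(A, B) \<in> T" by blast
    then show ?thesis using union_in_merge_along by (intro bexI[of _ "A \<union> B"]) auto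
  next
    case False
    then show ?thesis using that by (intro bexI[of _ B]) (simp_all add: merge_along_def)
  qed
qed

lemma merge_along_trace:
  assumes T: "T \<in> matchings P Q" and p: "p \<in> merge_along T P Q"
  shows "p \<inter> V \<in> insert {} P" "p \<inter> W \<in> insert {} Q"
proof -
  show "p \<inter> V \<in> insert {} P"
    using p by (cases rule: merge_along_cases[OF T]) auto
  show "p \<inter> W \<in> insert {} Q"
    using p by (cases rule: merge_along_cases[OF T]) auto
qed

lemma partition_on_merge_along:
  assumes T: "T \<in> matchings P Q"
  shows "partition_on (V \<union> W) (merge_along T P Q)"
proof -
  have sub: "p \<subseteq> V \<union> W" if p: "p \<in> merge_along T P Q" for p
    using p by (cases rule: merge_along_cases[OF T]) auto
  have sup: "x \<in> \<Union> (merge_along T P Q)" if "x \<in> V \<union> W" for x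
  proof -
    have "V = \<Union>P" "W = \<Union>Q"
      using P Q by (auto simp: partition_on_def)
    then consider A where "A \<in> P" "x \<in> A" | B where "B \<in> Q" "x \<in> B"
      using \<open>x \<in> V \<union> W\<close> by auto
    then show ?thesis
      proof cases
      case 1
      then show ?thesis using merge_along_cover(1)[OF 1(1), of T] by blast
    next
      case 2
      then show ?thesis using merge_along_cover(2)[OF 2(1), of T] by blast
    qed
  qed
  show ?thesis
proof (rule partition_onI)
  show "\<Union> (merge_along T P Q) = V \<union> W"
    by (rule subset_antisym, rule Sup_least, erule sub, rule subsetI, erule sup)
next
  fix p q assume p: "p \<in> merge_along T P Q" and q: "q \<in> merge_along T P Q" and "p \<noteq> q"
  note trace = merge_along_trace[OF T]
  show "disjnt p q"
  proof (rule ccontr)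
    assume "\<not> disjnt p q"
    then obtain x where x: "x \<in> p" "x \<in> q" by (auto simp: disjnt_def)
    then consider "x \<in> V" | "x \<in> W" using sub[OF p] by blast
    then show False
    proof cases
      case 1
      then have "p \<inter> V \<in> P" "q \<inter> V \<in> P" using trace(1)[OF p] trace(1)[OF q] x by auto
      then have "p \<inter> V = q \<inter> V" using partition_on_eqI[OF P] 1 x by blast
      then show False using merge_along_trace_inj(1)[OF T p q] 1 x \<open>p \<noteq> q\<close> by blast
    next
      case 2
      then have "p \<inter> W \<in> Q" "q \<inter> W \<in> Q" using trace(2)[OF p] trace(2)[OF q] x by auto
      then have "p \<inter> W = q \<inter> W" using partition_on_eqI[OF Q] 2 x by blast
      then show False using merge_along_trace_inj(2)[OF T p q] 2 x \<open>p \<noteq> q\<close> by blast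
    qed
  qed
next
  have "p \<noteq> {}" if p: "p \<in> merge_along T P Q" for p
    using p by (cases rule: merge_along_cases[OF T])
      (use partition_onD3[OF P] partition_onD3[OF Q] in auto)
  then show "{} \<notin> merge_along T P Q"
    by blast
qed
qed

lemma induced_merge_along:
  assumes T: "T \<in> matchings P Q"
  shows "induced_partition (merge_along T P Q) V = P"
    and "induced_partition (merge_along T P Q) W = Q"
proof -
  note 1 = merge_along_trace[OF T]
  have ne: "{} \<notin> P" "{} \<notin> Q"
    using P Q by (auto simp: partition_on_def)
  have "\<exists>p\<in>merge_along T P Q. p \<inter> V = A" if A: "A \<in> P" for A
  proof -
    obtain p where p: "p \<in> merge_along T P Q" "A \<subseteq> p" using merge_along_cover(1)[OF A] by blast
    have "A \<subseteq> V" "A \<noteq> {}" using partition_on_part[OF P A] by auto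
    then obtain x where x: "x \<in> A" "x \<in> p \<inter> V" using p by blast
    then have "p \<inter> V \<in> P" using 1[OF p(1)] by auto
    then have "p \<inter> V = A" using partition_on_eqI[OF P _ A x(2,1)] by simp
    then show ?thesis using p by blast
  qed
  then show "induced_partition (merge_along T P Q) V = P"
    using 1 ne by (intro induced_partition_eqI) simp_all
  have "\<exists>p\<in>merge_along T P Q. p \<inter> W = B" if B: "B \<in> Q" for B
  proof -
    obtain p where p: "p \<in> merge_along T P Q" "B \<subseteq> p" using merge_along_cover(2)[OF B] by blast
    have "B \<subseteq> W" "B \<noteq> {}" using partition_on_part[OF Q B] by auto
    then obtain x where x: "x \<in> B" "x \<in> p \<inter> W" using p by blast
    then have "p \<inter> W \<in> Q" using 1[OF p(1)] by auto
    then have "p \<inter> W = B" using partition_on_eqI[OF Q _ B x(2,1)] by simp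
    then show ?thesis using p by blast
  qed
  then show "induced_partition (merge_along T P Q) W = Q"
    using 1 ne by (intro induced_partition_eqI) simp_all
qed

lemma union_mem_merge_along:
  assumes T: "T \<in> matchings P Q" and A: "A \<in> P" and B: "B \<in> Q"
  shows "A \<union> B \<in> merge_along T P Q \<longleftrightarrow> (A, B) \<in> T"
proof
  assume "A \<union> B \<in> merge_along T P Q"
  then show "(A, B) \<in> T"
    using union_parts_Int[OF A B] partition_on_part[OF P A] partition_on_part[OF Q B]
    by (cases rule: merge_along_cases[OF T]) auto
qed (rule union_in_merge_along)

lemma split_pairs_merge_along:
  assumes T: "T \<in> matchings P Q"
  shows "split_pairs (merge_along T P Q) P Q = T"
  using union_mem_merge_along[OF T] T by (auto simp: split_pairs_def matchings_def)

text \<open>Every pair in \<open>T\<close> replaces two parts by one.\<close>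

lemma card_merge_along:
  assumes T: "T \<in> matchings P Q" and fin: "finite P" "finite Q"
  shows "card (merge_along T P Q) = card P + card Q - card T"
proof -
  have TPQ: "T \<subseteq> P \<times> Q" using T by (auto simp: matchings_def)
  have int: "(A \<union> B) \<inter> V = A \<and> (A \<union> B) \<inter> W = B \<and> A \<noteq> {} \<and> B \<noteq> {}" if "(A, B) \<in> T" for A B
  proof -
    have "A \<in> P" "B \<in> Q"
      using that TPQ by auto
    then show ?thesis
      using union_parts_Int[of A B] partition_on_part[OF P, of A] partition_on_part[OF Q, of B] by simp
  qed
  have "inj_on (\<lambda>(A, B). A \<union> B) T"
    by (rule inj_onI) (use int in \<open>clarsimp, metis\<close>)
  then have 1: "card ((\<lambda>(A, B). A \<union> B) ` T) = card T"
    by (rule card_image)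
  have 2: "card (P - Domain T) = card P - card T" "card (Q - Range T) = card Q - card T"
  proof -
    have "Domain T \<subseteq> P" "Range T \<subseteq> Q"
      using TPQ by auto
    then show "card (P - Domain T) = card P - card T" "card (Q - Range T) = card Q - card T"
      using fin card_matching(2,3)[OF T fin] by (metis card_Diff_subset finite_subset)+
  qed
  have 3: "((\<lambda>(A, B). A \<union> B) ` T) \<inter> (P - Domain T) = {}"
  proof -
    have "A \<union> B \<notin> P" if "(A, B) \<in> T" for A B
      using int[OF that] left_part_Int[of "A \<union> B"] by metis
    then show ?thesis by auto
  qed
  have 4: "((\<lambda>(A, B). A \<union> B) ` T \<union> (P - Domain T)) \<inter> (Q - Range T) = {}"
  proof -
    have "A \<union> B \<notin> Q" if "(A, B) \<in> T" for A B
      using int[OF that] right_part_Int[of "A \<union> B"] by metis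
    moreover have "A \<notin> Q" if "A \<in> P" for A
      using left_part_Int[OF that] right_part_Int[of A] partition_on_part[OF P that] by metis
    ultimately show ?thesis by auto
  qed
  show ?thesis
    unfolding merge_along_def using fin card_matching(1,4,5)[OF T fin] 1 2 3 4
    by (simp add: card_Un_disjoint)
qed

end

text \<open>Every partition of a disjoint union arises by merging the two induced partitions along a unique matching. A
  part meeting both sides is the union of its traces; a part meeting only one side is an unmatched part
  of the induced partition there.\<close>

lemma split_pairs_matching:
  assumes R: "partition_on (V \<union> W) R" and VW: "V \<inter> W = {}"
  defines "P \<equiv> induced_partition R V" and "Q \<equiv> induced_partition R W"
  shows "split_pairs R P Q \<in> matchings P Q" and "merge_along (split_pairs R P Q) P Q = R"
proof -
  have P: "partition_on V P" and Q: "partition_on W Q"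
    unfolding P_def Q_def by (auto intro: partition_on_induced[OF R])
  note part = partition_on_part[OF P] partition_on_part[OF Q]
  show T: "split_pairs R P Q \<in> matchings P Q"
  proof -
    have "B = B'" if "A \<in> P" "B \<in> Q" "B' \<in> Q" "A \<union> B \<in> R" "A \<union> B' \<in> R" for A B B'
    proof -
      have "A \<union> B = A \<union> B'"
        using partition_on_eqI[OF R that(4,5)] part(1)[OF that(1)] by blast
      then show ?thesis
        using union_parts_Int(2)[OF P Q VW] that by metis
    qed
    moreover have "A = A'" if "A \<in> P" "A' \<in> P" "B \<in> Q" "A \<union> B \<in> R" "A' \<union> B \<in> R" for A A' B
    proof -
      have "A \<union> B = A' \<union> B"
        using partition_on_eqI[OF R that(4,5)] part(2)[OF that(3)] by blast
      then show ?thesis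
        using union_parts_Int(1)[OF P Q VW] that by metis
    qed
    ultimately show ?thesis
      unfolding matchings_def split_pairs_def single_valued_def by blast
  qed
  let ?T = "split_pairs R P Q"
  have sub: "p \<in> merge_along ?T P Q" if p: "p \<in> R" for p
  proof -
    have pVW: "p = (p \<inter> V) \<union> (p \<inter> W)" "p \<noteq> {}"
      using partition_on_part[OF R p] by auto
    have tr: "p \<inter> V = {} \<or> p \<inter> V \<in> P" "p \<inter> W = {} \<or> p \<inter> W \<in> Q"
      using p unfolding P_def Q_def induced_partition_def by blast+
    consider "p \<inter> V \<in> P" "p \<inter> W \<in> Q" | "p \<in> P" "p \<inter> W = {}" | "p \<in> Q" "p \<inter> V = {}"
      using tr pVW by (metis sup_bot.left_neutral sup_bot.right_neutral)
    then show ?thesis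
    proof cases
      case 1
      then have "(p \<inter> V, p \<inter> W) \<in> ?T"
        using p pVW by (simp add: split_pairs_def)
      then show ?thesis
        using pVW union_in_merge_along[OF P Q VW] by metis
    next
      case 2
      have "p \<notin> Domain ?T"
      proof
        assume "p \<in> Domain ?T"
        then obtain B where B: "B \<in> Q" "p \<union> B \<in> R" by (auto simp: split_pairs_def)
        then have "p \<union> B = p" using partition_on_eqI[OF R _ p] pVW by blast
        then show False using B 2 part(2)[OF B(1)] by blast
      qed
      then show ?thesis using 2 by (simp add: merge_along_def)
    next
      case 3
      have "p \<notin> Range ?T"
      proof
        assume "p \<in> Range ?T"
        then obtain A where A: "A \<in> P" "A \<union> p \<in> R" by (auto simp: split_pairs_def)
        then have "A \<union> p = p" using partition_on_eqI[OF R _ p] pVW by blast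
        then show False using A 3 part(1)[OF A(1)] by blast
      qed
      then show ?thesis using 3 by (simp add: merge_along_def)
    qed
  qed
  \<comment> \<open>Two partitions of the same set, one contained in the other, are equal.\<close>
  have M: "partition_on (V \<union> W) (merge_along ?T P Q)"
    by (rule partition_on_merge_along[OF P Q VW T])
  have "p \<in> R" if p: "p \<in> merge_along ?T P Q" for p
  proof -
    obtain x where x: "x \<in> p" "x \<in> V \<union> W" using partition_on_part[OF M p] by blast
    then obtain p' where p': "p' \<in> R" "x \<in> p'" using R by (auto simp: partition_on_def)
    then show ?thesis using partition_on_eqI[OF M p sub[OF p'(1)] x(1)] by simp
  qed
  then show "merge_along ?T P Q = R" using sub by blast
qed

section \<open>Independent partitions of a disjoint union of graphs\<close>

definition independent_partitions :: "'a sgraph \<Rightarrow> 'a set set set" where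
  "independent_partitions G = {P. partition_on (verts G) P \<and> (\<forall>I\<in>P. independent_set G I)}"

lemma finite_independent_partitions: "finite (verts G) \<Longrightarrow> finite (independent_partitions G)"
  unfolding independent_partitions_def
  by (rule finite_subset[OF _ finitely_many_partition_on]) auto

definition graph_union :: "'a sgraph \<Rightarrow> 'a sgraph \<Rightarrow> 'a sgraph" where
  "graph_union G H = (verts G \<union> verts H, edges G \<union> edges H)"

text \<open>No edge joins the two graphs, so independence is tested on each side separately.\<close>

lemma independent_set_graph_union:
  assumes "edges G \<subseteq> Pow (verts G)" "edges H \<subseteq> Pow (verts H)"
  shows "independent_set (graph_union G H) I \<longleftrightarrow> I \<subseteq> verts G \<union> verts H \<and>
    independent_set G (I \<inter> verts G) \<and> independent_set H (I \<inter> verts H)"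
  (is "?L \<longleftrightarrow> ?R")
proof
  assume ?L
  then show ?R
    by (auto simp: independent_set_def graph_union_def)
next
  assume R: ?R
  have "{u, v} \<notin> edges G \<union> edges H" if uv: "u \<in> I" "v \<in> I" for u v
  proof
    assume "{u, v} \<in> edges G \<union> edges H"
    then consider "{u, v} \<in> edges G" "{u, v} \<subseteq> verts G" | "{u, v} \<in> edges H" "{u, v} \<subseteq> verts H"
      using assms by blast
    then show False
    proof cases
      case 1
      then show ?thesis using R uv by (simp add: independent_set_def)
    next
      case 2
      then show ?thesis using R uv by (simp add: independent_set_def)
    qed
  qed
  then show ?L
    using R by (simp add: independent_set_def graph_union_def)
qed

text \<open>Merging the independent partitions of \<open>G\<close> and \<open>H\<close> along all matchings lists the independent partitions of the
  disjoint union exactly once.\<close>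

lemma sum_independent_partitions_graph_union:
  assumes disj: "verts G \<inter> verts H = {}"
    and eG: "edges G \<subseteq> Pow (verts G)" and eH: "edges H \<subseteq> Pow (verts H)"
    and fin: "finite (verts G)" "finite (verts H)"
  shows "(\<Sum>R\<in>independent_partitions (graph_union G H). F R) =
    (\<Sum>P\<in>independent_partitions G. \<Sum>Q\<in>independent_partitions H.
       \<Sum>T\<in>matchings P Q. F (merge_along T P Q))"
proof -
  let ?V = "verts G" and ?W = "verts H" and ?U = "independent_partitions (graph_union G H)"
  let ?D = "SIGMA (P, Q) : independent_partitions G \<times> independent_partitions H. matchings P Q"
  let ?P = "\<lambda>R. induced_partition R ?V" and ?Q = "\<lambda>R. induced_partition R ?W"
  note indep = independent_set_graph_union[OF eG eH]
  have empty: "independent_set G {}" "independent_set H {}"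
    by (auto simp: independent_set_def)
  have mergeI: "merge_along T P Q \<in> ?U"
    if "P \<in> independent_partitions G" "Q \<in> independent_partitions H" "T \<in> matchings P Q" for P Q T
  proof -
    have P: "partition_on ?V P" and Q: "partition_on ?W Q"
      using that by (auto simp: independent_partitions_def)
    have M: "partition_on (?V \<union> ?W) (merge_along T P Q)"
      by (rule partition_on_merge_along[OF P Q disj that(3)])
    have parts: "independent_set G A" if "A \<in> insert {} P" for A
      using that empty \<open>P \<in> _\<close> by (auto simp: independent_partitions_def)
    have parts': "independent_set H B" if "B \<in> insert {} Q" for B
      using that empty \<open>Q \<in> _\<close> by (auto simp: independent_partitions_def)
    have "independent_set G (I \<inter> ?V)" "independent_set H (I \<inter> ?W)" if "I \<in> merge_along T P Q" for I
      using merge_along_trace[OF P Q disj \<open>T \<in> matchings P Q\<close> that] parts parts' by blast+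
    then have "independent_set (graph_union G H) I" if "I \<in> merge_along T P Q" for I
      using that partition_on_part[OF M that] by (simp add: indep)
    then show ?thesis
      using M by (simp add: independent_partitions_def graph_union_def)
  qed
  have splitI: "?P R \<in> independent_partitions G" "?Q R \<in> independent_partitions H"
    "split_pairs R (?P R) (?Q R) \<in> matchings (?P R) (?Q R)"
    "merge_along (split_pairs R (?P R) (?Q R)) (?P R) (?Q R) = R" if "R \<in> ?U" for R
  proof -
    have R: "partition_on (?V \<union> ?W) R" and I: "\<And>I. I \<in> R \<Longrightarrow> independent_set (graph_union G H) I"
      using that by (auto simp: independent_partitions_def graph_union_def)
    have "partition_on ?V (?P R)" "partition_on ?W (?Q R)"
      using partition_on_induced[OF R] by auto
    then show "?P R \<in> independent_partitions G" "?Q R \<in> independent_partitions H"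
      using I[unfolded indep] unfolding independent_partitions_def induced_partition_def by auto
    show "split_pairs R (?P R) (?Q R) \<in> matchings (?P R) (?Q R)"
      "merge_along (split_pairs R (?P R) (?Q R)) (?P R) (?Q R) = R"
      using split_pairs_matching[OF R disj] by auto
  qed
  have inv: "?P (merge_along T P Q) = P" "?Q (merge_along T P Q) = Q"
    "split_pairs (merge_along T P Q) P Q = T"
    if "P \<in> independent_partitions G" "Q \<in> independent_partitions H" "T \<in> matchings P Q" for P Q T
    using that induced_merge_along[OF _ _ disj] split_pairs_merge_along[OF _ _ disj]
    by (auto simp: independent_partitions_def)
  have "(\<Sum>R\<in>?U. F R) = (\<Sum>((P, Q), T)\<in>?D. F (merge_along T P Q))"
    by (rule sum.reindex_bij_witness[where i = "\<lambda>((P, Q), T). merge_along T P Q"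
          and j = "\<lambda>R. ((?P R, ?Q R), split_pairs R (?P R) (?Q R))"])
      (auto simp: splitI mergeI inv)
  also have "\<dots> = (\<Sum>(P, Q)\<in>independent_partitions G \<times> independent_partitions H.
       \<Sum>T\<in>matchings P Q. F (merge_along T P Q))"
  proof -
    have "finite (matchings P Q)" if "P \<in> independent_partitions G" "Q \<in> independent_partitions H" for P Q
      using that fin unfolding independent_partitions_def
      by (blast intro: finite_matchings finite_elements)
    then have "\<forall>PQ\<in>independent_partitions G \<times> independent_partitions H.
        finite (case PQ of (P, Q) \<Rightarrow> matchings P Q)"
      by auto
    moreover have "finite (independent_partitions G \<times> independent_partitions H)"
      using fin by (intro finite_cartesian_product finite_independent_partitions)
    ultimately show ?thesis
      by (subst sum.Sigma[symmetric]) (auto simp: split_def)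
  qed
  also have "\<dots> = (\<Sum>P\<in>independent_partitions G. \<Sum>Q\<in>independent_partitions H.
       \<Sum>T\<in>matchings P Q. F (merge_along T P Q))"
    by (simp add: sum.cartesian_product)
  finally show ?thesis .
qed

section \<open>Products of normally ordered monomials as sums over merged partitions\<close>

text \<open>The middle factor $D^{|P|} x^{|Q|}$ is a sum over placements of 1's in a $|P| \times |Q|$ matrix. Numbering
  the parts of \<open>P\<close> and \<open>Q\<close> by the lists \<open>xs\<close> and \<open>ys\<close> identifies these placements with the
  matchings of parts, and the placement is then the merge matrix. Both exponents of the resulting monomial are
  $|P| + |Q|$ minus the number of 1's, which is the number of parts after merging. In particular the sum is the same
  for every numbering, which is why the total order in the definition of the weight is arbitrary.\<close>

lemma normal_order_merge:
  assumes P: "partition_on V P" and Q: "partition_on W Q" and VW: "V \<inter> W = {}"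
    and xs: "set xs = P" "distinct xs" and ys: "set ys = Q" "distinct ys"
  shows "weyl_x ^ card P * weyl_D ^ card P * (weyl_x ^ card Q * weyl_D ^ card Q) =
    (\<Sum>T\<in>matchings P Q.
       weyl_scalar (q_var ^ matrix_weight (merge_matrix (merge_along T P Q) xs ys))
         * weyl_x ^ card (merge_along T P Q) * weyl_D ^ card (merge_along T P Q))"
proof -
  let ?I = "{..<length xs}" and ?J = "{..<length ys}"
  let ?m = "image (map_prod (nth xs) (nth ys))"
  have fin: "finite P" "finite Q"
    using xs ys by auto
  have card: "card P = card ?I" "card Q = card ?J"
    using xs ys distinct_card by fastforce+
  have bij: "bij_betw (nth xs) ?I P" "bij_betw (nth ys) ?J Q"
    using xs ys by (auto intro: bij_betw_nth)
  have bijm: "bij_betw ?m (matchings ?I ?J) (matchings P Q)"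
    by (rule bij_betw_matchings[OF bij])
  have weight: "matrix_weight (merge_matrix (merge_along (?m R) P Q) xs ys) = card (free_cells ?I ?J R)"
    if R: "R \<in> matchings ?I ?J" for R
  proof -
    let ?M = "merge_matrix (merge_along (?m R) P Q) xs ys"
    have T: "?m R \<in> matchings P Q"
      using bijm R by (auto simp: bij_betw_def)
    have dim: "dim_row ?M = length xs" "dim_col ?M = length ys"
      by (simp_all add: merge_matrix_def)
    have entry: "?M $$ (i, j) = (if (i, j) \<in> R then 1 else 0)" if "i < length xs" "j < length ys" for i j
    proof -
      have "xs ! i \<in> P" "ys ! j \<in> Q"
        using that xs ys by auto
      then have "xs ! i \<union> ys ! j \<in> merge_along (?m R) P Q \<longleftrightarrow> (xs ! i, ys ! j) \<in> ?m R"
        by (rule union_mem_merge_along[OF P Q VW T])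
      also have "\<dots> \<longleftrightarrow> (i, j) \<in> R"
      proof
        assume "(xs ! i, ys ! j) \<in> ?m R"
        then obtain i' j' where ij: "(i', j') \<in> R" "xs ! i = xs ! i'" "ys ! j = ys ! j'"
          by auto
        then have "i' < length xs" "j' < length ys"
          using R by (auto simp: matchings_def)
        then show "(i, j) \<in> R"
          using ij that xs(2) ys(2) by (simp add: nth_eq_iff_index_eq)
      qed (rule rev_image_eqI, auto)
      finally show ?thesis
        using that by (simp add: merge_matrix_def)
    qed
    show ?thesis
      using matrix_weight_eq_card_free_cells[of R ?M] R entry unfolding dim
      by (simp add: matchings_def)
  qed
  have card_m: "card (?m R) = card R" if "R \<in> matchings ?I ?J" for R
  proof -
    have "inj_on (map_prod (nth xs) (nth ys)) (?I \<times> ?J)"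
      using bij by (auto simp: bij_betw_def intro: map_prod_inj_on)
    moreover have "R \<subseteq> ?I \<times> ?J"
      using that by (simp add: matchings_def)
    ultimately show ?thesis
      by (rule card_image[OF inj_on_subset])
  qed
  have "weyl_x ^ card P * weyl_D ^ card P * (weyl_x ^ card Q * weyl_D ^ card Q) =
      weyl_x ^ card P * (weyl_D ^ card ?I * weyl_x ^ card ?J) * weyl_D ^ card Q"
    by (simp only: card mult.assoc)
  also have "\<dots> = (\<Sum>R\<in>matchings ?I ?J. weyl_scalar (q_var ^ card (free_cells ?I ?J R))
      * (weyl_x ^ card P * weyl_x ^ (card ?J - card R)) * (weyl_D ^ (card ?I - card R) * weyl_D ^ card Q))"
    unfolding D_power_x_power[OF finite_lessThan finite_lessThan] sum_distrib_left sum_distrib_right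
    unfolding mult.assoc weyl_scalar_left_commute[of "weyl_x ^ _"] ..
  also have "\<dots> = (\<Sum>R\<in>matchings ?I ?J.
       weyl_scalar (q_var ^ matrix_weight (merge_matrix (merge_along (?m R) P Q) xs ys))
         * weyl_x ^ card (merge_along (?m R) P Q) * weyl_D ^ card (merge_along (?m R) P Q))"
  proof (rule sum.cong[OF refl])
    fix R assume R: "R \<in> matchings ?I ?J"
    have T: "?m R \<in> matchings P Q"
      using bijm R by (auto simp: bij_betw_def)
    have "card R \<le> card ?I" "card R \<le> card ?J"
      using card_matching(4,5)[OF R] by simp_all
    then have "card P + (card ?J - card R) = card (merge_along (?m R) P Q)"
      "card ?I - card R + card Q = card (merge_along (?m R) P Q)"
      unfolding card_merge_along[OF P Q VW T fin] card_m[OF R] card by simp_all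
    then show "weyl_scalar (q_var ^ card (free_cells ?I ?J R))
      * (weyl_x ^ card P * weyl_x ^ (card ?J - card R)) * (weyl_D ^ (card ?I - card R) * weyl_D ^ card Q)
      = weyl_scalar (q_var ^ matrix_weight (merge_matrix (merge_along (?m R) P Q) xs ys))
         * weyl_x ^ card (merge_along (?m R) P Q) * weyl_D ^ card (merge_along (?m R) P Q)"
      by (simp only: weight[OF R] flip: power_add)
  qed
  also have "\<dots> = (\<Sum>T\<in>matchings P Q.
       weyl_scalar (q_var ^ matrix_weight (merge_matrix (merge_along T P Q) xs ys))
         * weyl_x ^ card (merge_along T P Q) * weyl_D ^ card (merge_along T P Q))"
    by (rule sum.reindex_bij_betw[OF bijm])
  finally show ?thesis .
qed

lemma sorted_enumeration_exists:
  assumes "linear_order_on S r" "finite A" "A \<subseteq> S"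
  shows "\<exists>xs. set xs = A \<and> distinct xs \<and> sorted_wrt (\<lambda>a b. (a, b) \<in> r) xs"
  using assms(2,3)
proof (induction A rule: finite_psubset_induct)
  case (psubset A)
  show ?case
  proof (cases "A = {}")
    case False
    have lin: "trans r" "total_on S r" "refl_on S r"
      using assms(1) by (auto simp: linear_order_on_def partial_order_on_def preorder_on_def)
    have "\<exists>m\<in>A. \<forall>a\<in>A. (m, a) \<in> r"
      using psubset.hyps(1) False psubset.prems
    proof (induction A rule: finite_ne_induct)
      case (singleton x)
      then show ?case using lin(3) by (auto simp: refl_on_def)
    next
      case (insert x F)
      then obtain m where m: "m \<in> F" "\<forall>a\<in>F. (m, a) \<in> r" by auto
      have "(x, m) \<in> r \<or> (m, x) \<in> r"
        using lin(2) insert m by (metis insert_subset subsetD total_on_def)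
      moreover have "(x, x) \<in> r"
        using lin(3) insert by (auto simp: refl_on_def)
      ultimately show ?case
        using m transD[OF lin(1), of x m] by blast
    qed
    then obtain m where m: "m \<in> A" "\<forall>a\<in>A. (m, a) \<in> r" by blast
    obtain xs where "set xs = A - {m}" "distinct xs" "sorted_wrt (\<lambda>a b. (a, b) \<in> r) xs"
      using psubset.IH[of "A - {m}"] m psubset.prems by blast
    then show ?thesis
      using m by (intro exI[of _ "m # xs"]) auto
  qed simp
qed

lemma sorted_enumeration_unique:
  assumes "antisym r" "set xs = set ys" "distinct xs" "distinct ys"
    "sorted_wrt (\<lambda>a b. (a, b) \<in> r) xs" "sorted_wrt (\<lambda>a b. (a, b) \<in> r) ys"
  shows "xs = ys"
  using assms(2-)
proof (induction xs arbitrary: ys)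
  case Nil
  then show ?case by simp
next
  case (Cons x xs)
  then obtain y ys' where ys: "ys = y # ys'"
    by (cases ys) auto
  have "x = y"
  proof (rule ccontr)
    assume "x \<noteq> y"
    then have "x \<in> set ys'" "y \<in> set xs"
      using Cons.prems(1) unfolding ys by auto
    then have "(x, y) \<in> r" "(y, x) \<in> r"
      using Cons.prems(4,5) unfolding ys by auto
    then show False
      using antisymD[OF assms(1)] \<open>x \<noteq> y\<close> by blast
  qed
  moreover have "set xs = set ys'"
    using Cons.prems(1-3) \<open>x = y\<close> unfolding ys by (auto simp: set_eq_iff)
  ultimately show ?case
    using Cons.IH[of ys'] Cons.prems unfolding ys by simp
qed

text \<open>A description by \<^const>\<open>The\<close> is meaningful only if such a list exists and is unique. It then enumerates
  \<open>A\<close> without repetition, as \<open>normal_order_merge\<close> requires.\<close>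

lemma increasing_list:
  assumes "linear_order_on S r" "finite A" "A \<subseteq> S"
  shows "set (increasing_list r A) = A" "distinct (increasing_list r A)"
proof -
  have "antisym r"
    using assms(1) by (simp add: linear_order_on_def partial_order_on_def)
  then have "\<exists>!xs. set xs = A \<and> distinct xs \<and> sorted_wrt (\<lambda>a b. (a, b) \<in> r) xs"
    using sorted_enumeration_exists[OF assms] sorted_enumeration_unique[of r]
    by (intro ex_ex1I) simp_all
  from theI'[OF this, folded increasing_list_def]
  show "set (increasing_list r A) = A" "distinct (increasing_list r A)"
    by simp_all
qed

section \<open>Graphs of Dyck words\<close>

lemma dyck_append:
  assumes "dyck u" "dyck v"
  shows "dyck (u @ v)"
  using assms unfolding dyck_def balanced_def prefix_append
  by (auto simp: add_mono)

lemma dyck_concat: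
  assumes "us \<noteq> []" "\<forall>u\<in>set us. dyck_irreducible u"
  shows "dyck (concat us)"
  using assms
proof (induction us rule: list_nonempty_induct)
  case (single u)
  then show ?case by (simp add: dyck_irreducible_imp_dyck)
next
  case (cons u us)
  then show ?case by (simp add: dyck_irreducible_imp_dyck dyck_append)
qed

lemma dyck_factors_concat:
  assumes "us \<noteq> []" "\<forall>u\<in>set us. dyck_irreducible u"
  shows "dyck_factors (concat us) = us"
  using dyck_factors[OF dyck_concat[OF assms]] assms(2) by (intro dyck_factors_unique) auto

lemma dyck_irreducible_concat:
  assumes "us \<noteq> []" "\<forall>u\<in>set us. dyck_irreducible u" "dyck_irreducible (concat us)"
  shows "us = [concat us]"
  using assms by (intro dyck_factors_unique) auto

text \<open>The disjoint union of the graphs of consecutive factors, peeled off from the left as in the recursion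
  of \<^const>\<open>partition_weight_at\<close>. The recursion of \<^const>\<open>dyck_graph_at\<close> treats all factors at once;
  \<open>dyck_graph_at_concat\<close> shows that the two agree, also for a single factor.\<close>

fun factors_graph :: "nat \<Rightarrow> letter list list \<Rightarrow> nat sgraph" where
  "factors_graph n [] = ({}, {})"
| "factors_graph n (u # us) = graph_union (dyck_graph_at n u) (factors_graph (n + length u) us)"

lemma factors_graph_eq:
  "factors_graph n ws =
    (\<Union>i<length ws. verts (dyck_graph_at (n + length (concat (take i ws))) (ws ! i)),
     \<Union>i<length ws. edges (dyck_graph_at (n + length (concat (take i ws))) (ws ! i)))"
proof (induction ws arbitrary: n)
  case (Cons u us)
  have "{..<length (u # us)} = insert 0 (Suc ` {..<length us})"
    by (simp add: lessThan_Suc_eq_insert_0)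
  then show ?case
    by (simp only: factors_graph.simps Cons graph_union_def) (simp add: add.assoc)
qed simp

lemma dyck_graph_at_concat:
  assumes "us \<noteq> []" "\<forall>u\<in>set us. dyck_irreducible u"
  shows "dyck_graph_at n (concat us) = factors_graph n us"
proof (cases "dyck_irreducible (concat us)")
  case True
  then obtain u where "us = [u]"
    using dyck_irreducible_concat[OF assms] by metis
  then show ?thesis
    by (simp add: graph_union_def)
next
  case False
  then have "concat us \<noteq> [X, D]"
    by (auto simp: dyck_irreducible_def)
  then show ?thesis
    using False dyck_concat[OF assms]
    by (subst dyck_graph_at.simps)
      (simp add: dyck_factors_concat[OF assms] factors_graph_eq Let_def atLeast0LessThan)
qed

text \<open>The graph of a reducible word is the union of the graph of its first factor and the graph of the word formed by
  all other factors, which may itself be irreducible or reducible.\<close>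

lemma dyck_reducible_split:
  assumes "dyck w" "\<not> dyck_irreducible w"
  defines "u \<equiv> hd (dyck_factors w)" and "v \<equiv> concat (tl (dyck_factors w))"
  shows "w = u @ v" "dyck u" "dyck v"
    "dyck_graph_at n w = graph_union (dyck_graph_at n u) (dyck_graph_at (n + length u) v)"
proof -
  note f = dyck_factors[OF assms(1)]
  obtain us where us: "dyck_factors w = u # us"
    using f(2) assms(1) unfolding u_def by (cases "dyck_factors w") (auto simp: dyck_def)
  have irr: "\<forall>u\<in>set (u # us). dyck_irreducible u" and w: "w = concat (u # us)"
    using f us by simp_all
  have v: "v = concat us"
    by (simp add: v_def us)
  have "us \<noteq> []"
    using assms(2) w irr by auto
  then show "w = u @ v" "dyck u" "dyck v"
    using w irr by (simp_all add: v dyck_irreducible_imp_dyck dyck_concat)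
  show "dyck_graph_at n w = graph_union (dyck_graph_at n u) (dyck_graph_at (n + length u) v)"
    unfolding w v using irr \<open>us \<noteq> []\<close> by (subst dyck_graph_at_concat) (simp_all add: dyck_graph_at_concat)
qed

lemma dyck_irreducible_inner:
  assumes "dyck_irreducible w" "w \<noteq> [X, D]"
  shows "dyck (dyck_inner w)" "w = X # dyck_inner w @ [D]"
    "dyck_graph_at n w = add_dominating n (dyck_graph_at (Suc n) (dyck_inner w))"
  using assms by (auto simp: dyck_irreducible_def dyck_inner_def dyck_graph_at.simps[of n w])

lemma dyck_cases [consumes 1, case_names base irreducible reducible]:
  assumes "dyck w"
  obtains "w = [X, D]" | "w \<noteq> [X, D]" "dyck_irreducible w" | "\<not> dyck_irreducible w"
  using assms by blast

text \<open>The range of the vertices makes the dominating vertex new and the graphs of different factors disjoint.\<close>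

lemma dyck_graph_at_wf:
  assumes "dyck w"
  shows "verts (dyck_graph_at n w) \<subseteq> {n..<n + length w}"
    and "edges (dyck_graph_at n w) \<subseteq> Pow (verts (dyck_graph_at n w))"
proof -
  have "verts (dyck_graph_at n w) \<subseteq> {n..<n + length w} \<and>
      edges (dyck_graph_at n w) \<subseteq> Pow (verts (dyck_graph_at n w))"
    using assms
  proof (induction "length w" arbitrary: n w rule: less_induct)
    case less
    from less.prems show ?case
    proof (cases rule: dyck_cases)
      case base
      then show ?thesis by (simp add: dyck_graph_at.simps)
    next
      case irreducible
      note inner = dyck_irreducible_inner[OF irreducible(2,1)]
      have len: "length w = Suc (Suc (length (dyck_inner w)))"
        using arg_cong[OF inner(2), of length] by simp
      show ?thesis
        using less.hyps[of "dyck_inner w" "Suc n"] inner(1) len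
        unfolding inner(3)[of n] add_dominating_def by auto
    next
      case reducible
      note split = dyck_reducible_split[OF less.prems reducible]
      note len = length_dyck_split[OF less.prems reducible]
      have "length w = length (hd (dyck_factors w)) + length (concat (tl (dyck_factors w)))"
        using arg_cong[OF split(1), of length] by simp
      then show ?thesis
        using less.hyps[OF len(1) split(2), of n]
          less.hyps[OF len(2) split(3), of "n + length (hd (dyck_factors w))"]
        unfolding split(4)[of n] graph_union_def by auto
    qed
  qed
  then show "verts (dyck_graph_at n w) \<subseteq> {n..<n + length w}"
    "edges (dyck_graph_at n w) \<subseteq> Pow (verts (dyck_graph_at n w))"
    by blast+
qed

lemma independent_set_graph_unionI:
  assumes "verts G \<inter> verts H = {}" "edges G \<subseteq> Pow (verts G)" "edges H \<subseteq> Pow (verts H)"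
  shows "independent_set G I \<Longrightarrow> independent_set (graph_union G H) I"
    and "independent_set H I \<Longrightarrow> independent_set (graph_union G H) I"
proof -
  have empty: "independent_set G {}" "independent_set H {}"
    by (simp_all add: independent_set_def)
  show "independent_set (graph_union G H) I" if I: "independent_set G I"
  proof -
    have "I \<subseteq> verts G"
      using I by (simp add: independent_set_def)
    moreover from this have "I \<inter> verts G = I" "I \<inter> verts H = {}"
      using assms(1) by blast+
    ultimately show ?thesis
      using I empty by (simp add: independent_set_graph_union[OF assms(2,3)] le_supI1)
  qed
  show "independent_set (graph_union G H) I" if I: "independent_set H I"
  proof -
    have "I \<subseteq> verts H"
      using I by (simp add: independent_set_def)
    moreover from this have "I \<inter> verts H = I" "I \<inter> verts G = {}"
      using assms(1) by blast+
    ultimately show ?thesis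
      using I empty by (simp add: independent_set_graph_union[OF assms(2,3)] le_supI2)
  qed
qed

text \<open>A dominating vertex shares an independent set with no other vertex.\<close>

lemma independent_set_add_dominating:
  assumes v: "v \<notin> verts G" and e: "edges G \<subseteq> Pow (verts G)"
  shows "independent_set (add_dominating v G) I \<longleftrightarrow> I = {v} \<or> independent_set G I"
proof -
  have dom: "independent_set (add_dominating v G) J \<longleftrightarrow> J \<subseteq> insert v (verts G) \<and>
      (\<forall>a\<in>J. \<forall>b\<in>J. {a, b} \<notin> edges G \<and> (\<forall>u\<in>verts G. {a, b} \<noteq> {v, u}))" for J
    by (simp add: independent_set_def add_dominating_def) blast
  show ?thesis
  proof
    assume I: "independent_set (add_dominating v G) I"
    then have sub: "I \<subseteq> insert v (verts G)" and no_e: "\<forall>a\<in>I. \<forall>b\<in>I. {a, b} \<notin> edges G"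
      and no_v: "\<And>a b u. a \<in> I \<Longrightarrow> b \<in> I \<Longrightarrow> u \<in> verts G \<Longrightarrow> {a, b} \<noteq> {v, u}"
      by (simp_all add: dom)
    show "I = {v} \<or> independent_set G I"
    proof (cases "v \<in> I")
      case True
      have "u = v" if "u \<in> I" for u
        using no_v[OF True that, of u] sub that by blast
      then show ?thesis using True by blast
    next
      case False
      then show ?thesis
        using sub no_e by (auto simp: independent_set_def)
    qed
  next
    assume "I = {v} \<or> independent_set G I"
    then show "independent_set (add_dominating v G) I"
    proof
      assume "I = {v}"
      moreover have "{v, v} \<notin> edges G"
        using e v by blast
      moreover have "{v, v} \<noteq> {v, u}" if "u \<in> verts G" for u
        using v that by (auto simp: doubleton_eq_iff)
      ultimately show ?thesis
        by (simp add: dom)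
    next
      assume I: "independent_set G I"
      then have sub: "I \<subseteq> verts G" by (simp add: independent_set_def)
      have "{a, b} \<noteq> {v, u}" if "a \<in> I" "b \<in> I" for a b u
      proof
        assume "{a, b} = {v, u}"
        then have "v \<in> {a, b}" by simp
        then show False using that sub v by blast
      qed
      then show ?thesis
        using I sub unfolding dom by (simp add: independent_set_def subset_insertI2)
    qed
  qed
qed

text \<open>The dominating vertex is a singleton part of every independent partition, so adding and removing this part are
  inverse bijections.\<close>

lemma sum_independent_partitions_add_dominating:
  assumes v: "v \<notin> verts G" and e: "edges G \<subseteq> Pow (verts G)"
  shows "(\<Sum>R\<in>independent_partitions (add_dominating v G). F R) =
    (\<Sum>P\<in>independent_partitions G. F (insert {v} P))"
proof (rule sum.reindex_bij_witness[where i = "insert {v}" and j = "\<lambda>R. R - {{v}}"])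
  note indep = independent_set_add_dominating[OF v e]
  have vG: "verts (add_dominating v G) = insert v (verts G)"
    by (simp add: add_dominating_def)
  fix R assume "R \<in> independent_partitions (add_dominating v G)"
  then have R: "partition_on (insert v (verts G)) R" and I: "\<And>I. I \<in> R \<Longrightarrow> I = {v} \<or> independent_set G I"
    by (auto simp: independent_partitions_def indep vG)
  obtain I where "I \<in> R" "v \<in> I"
    using partition_onD1[OF R] by blast
  then have "I = {v}"
    using I[of I] v by (auto simp: independent_set_def)
  then have vR: "{v} \<in> R"
    using \<open>I \<in> R\<close> by simp
  then show "insert {v} (R - {{v}}) = R"
    by blast
  then show "F (insert {v} (R - {{v}})) = F R"
    by simp
  have "partition_on (insert v (verts G) - {v}) (R - {{v}})"
  proof -
    have "v \<notin> J" if "J \<in> R - {{v}}" for J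
      using partition_on_eqI[OF R _ vR] that by blast
    moreover have "\<Union>R = insert v (verts G)"
      using partition_onD1[OF R] by simp
    ultimately have "\<Union>(R - {{v}}) = insert v (verts G) - {v}"
      by blast
    moreover have "disjoint (R - {{v}})"
      using partition_onD2[OF R] by (rule pairwise_subset) blast
    ultimately show ?thesis
      using partition_onD3[OF R] by (simp add: partition_on_def)
  qed
  then show "R - {{v}} \<in> independent_partitions G"
    using v I by (auto simp: independent_partitions_def)
next
  fix P assume "P \<in> independent_partitions G"
  then have P: "partition_on (verts G) P" and I: "\<And>I. I \<in> P \<Longrightarrow> independent_set G I"
    by (auto simp: independent_partitions_def)
  have "{v} \<notin> P"
    using partition_on_part[OF P] v by blast
  then show "insert {v} P - {{v}} = P"
    by simp
  have "partition_on (insert v (verts G)) (insert {v} P)"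
    using P v by (auto simp: partition_on_def disjoint_def)
  then show "insert {v} P \<in> independent_partitions (add_dominating v G)"
    using I by (auto simp: independent_partitions_def add_dominating_def
        independent_set_add_dominating[OF v e, unfolded add_dominating_def])
qed

section \<open>Expansion of Dyck words\<close>

text \<open>Summing over partitions, rather than over the number \<open>k\<close> of parts, keeps one monomial per partition and lets each
  case of the recursion become a bijection of index sets. The offset \<open>n\<close> and the carrier
  \<open>S\<close> of the order are free because the recursion passes to subgraphs, whose independent sets are among those of the whole graph.\<close>

lemma weyl_word_expansion:
  assumes "dyck w" "linear_order_on S r" "{I. independent_set (dyck_graph_at n w) I} \<subseteq> S"
  shows "weyl_word w = (\<Sum>P\<in>independent_partitions (dyck_graph_at n w).
    weyl_scalar (q_var ^ partition_weight_at r n w P) * weyl_x ^ card P * weyl_D ^ card P)"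
  using assms(1,3)
proof (induction "length w" arbitrary: n w rule: less_induct)
  case less
  from less.prems(1) show ?case
  proof (cases rule: dyck_cases)
    case base
    have graph: "dyck_graph_at n w = ({n}, {})"
      by (simp add: base dyck_graph_at.simps)
    have "independent_partitions (({n}, {}) :: nat sgraph) = {{{n}}}"
    proof -
      have "P = {{n}}" if P: "partition_on {n} P" for P
      proof -
        have "p = {n}" if "p \<in> P" for p
          using partition_on_part[OF P that] by blast
        moreover have "P \<noteq> {}"
          using partition_onD1[OF P] by auto
        ultimately show ?thesis
          by blast
      qed
      then show ?thesis
        by (auto simp: independent_partitions_def independent_set_def partition_on_def)
    qed
    then show ?thesis
      using weyl_word_append[of "[X]" "[D]"]
      by (simp add: graph) (simp add: base partition_weight_at.simps)
  next
    case irreducible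
    let ?v = "dyck_inner w"
    let ?G = "dyck_graph_at (Suc n) ?v"
    note inner = dyck_irreducible_inner[OF irreducible(2,1)]
    note wf = dyck_graph_at_wf[OF inner(1), of "Suc n"]
    have n: "n \<notin> verts ?G"
      using wf(1) by auto
    have weight: "partition_weight_at r n w (insert {n} P) = partition_weight_at r (Suc n) ?v P"
      and card: "card (insert {n} P) = Suc (card P)" if "P \<in> independent_partitions ?G" for P
    proof -
      have P: "partition_on (verts ?G) P"
        using that by (simp add: independent_partitions_def)
      have nP: "{n} \<notin> P"
        using partition_on_part[OF P] n by blast
      then show "partition_weight_at r n w (insert {n} P) = partition_weight_at r (Suc n) ?v P"
        using irreducible by (subst partition_weight_at.simps) simp
      have "finite P"
        using finite_elements[OF finite_subset[OF wf(1)] P] by simp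
      then show "card (insert {n} P) = Suc (card P)"
        using nP by simp
    qed
    have "{I. independent_set ?G I} \<subseteq> S"
      using less.prems(2) unfolding inner(3)[of n] independent_set_add_dominating[OF n wf(2)] by auto
    then have IH: "weyl_word ?v = (\<Sum>P\<in>independent_partitions ?G.
        weyl_scalar (q_var ^ partition_weight_at r (Suc n) ?v P) * weyl_x ^ card P * weyl_D ^ card P)"
      using length_dyck_inner[OF irreducible(2)] inner(1) by (intro less.hyps)
    have "weyl_word w = weyl_x * weyl_word ?v * weyl_D"
      by (subst inner(2)) (simp add: mult.assoc flip: weyl_word_append)
    also have "\<dots> = (\<Sum>P\<in>independent_partitions ?G.
        weyl_scalar (q_var ^ partition_weight_at r (Suc n) ?v P) * weyl_x ^ Suc (card P) * weyl_D ^ Suc (card P))"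
      unfolding IH sum_distrib_left sum_distrib_right
      unfolding mult.assoc weyl_scalar_left_commute[of weyl_x]
      by (simp only: power_Suc[of weyl_x] power_Suc2[of weyl_D] mult.assoc)
    also have "\<dots> = (\<Sum>P\<in>independent_partitions ?G.
        weyl_scalar (q_var ^ partition_weight_at r n w (insert {n} P))
          * weyl_x ^ card (insert {n} P) * weyl_D ^ card (insert {n} P))"
      by (intro sum.cong refl) (simp only: weight card)
    also have "\<dots> = (\<Sum>P\<in>independent_partitions (dyck_graph_at n w).
        weyl_scalar (q_var ^ partition_weight_at r n w P) * weyl_x ^ card P * weyl_D ^ card P)"
      unfolding inner(3)[of n] by (rule sum_independent_partitions_add_dominating[OF n wf(2), symmetric])
    finally show ?thesis .
  next
    case reducible
    define u where "u = hd (dyck_factors w)"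
    define v where "v = concat (tl (dyck_factors w))"
    define m where "m = n + length u"
    define G where "G = dyck_graph_at n u"
    define H where "H = dyck_graph_at m v"
    note split = dyck_reducible_split[OF less.prems(1) reducible, folded u_def v_def]
    have graph: "dyck_graph_at n w = graph_union G H"
      unfolding G_def H_def m_def by (rule split(4))
    note len = length_dyck_split[OF less.prems(1) reducible, folded u_def v_def]
    note wfG = dyck_graph_at_wf[OF split(2), of n, folded G_def]
    note wfH = dyck_graph_at_wf[OF split(3), of m, folded H_def]
    have fin: "finite (verts G)" "finite (verts H)"
      using finite_subset[OF wfG(1)] finite_subset[OF wfH(1)] by simp_all
    have "{n..<n + length u} \<inter> {m..<m + length v} = {}"
      by (auto simp: m_def)
    then have disj: "verts G \<inter> verts H = {}"
      using wfG(1) wfH(1) by blast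
    note indep = independent_set_graph_unionI[OF disj wfG(2) wfH(2), folded graph]
    have S: "{I. independent_set G I} \<subseteq> S" "{I. independent_set H I} \<subseteq> S"
      using less.prems(2) indep by auto
    let ?wG = "partition_weight_at r n u" and ?wH = "partition_weight_at r m v"
    have IH: "weyl_word u = (\<Sum>P\<in>independent_partitions G.
        weyl_scalar (q_var ^ ?wG P) * weyl_x ^ card P * weyl_D ^ card P)"
      "weyl_word v = (\<Sum>Q\<in>independent_partitions H.
        weyl_scalar (q_var ^ ?wH Q) * weyl_x ^ card Q * weyl_D ^ card Q)"
      unfolding G_def H_def using len split(2,3) S unfolding G_def H_def by (intro less.hyps; simp)+
    let ?term = "\<lambda>R. weyl_scalar (q_var ^ partition_weight_at r n w R) * weyl_x ^ card R * weyl_D ^ card R"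
    \<comment> \<open>The monomials of \<open>P\<close> and \<open>Q\<close> multiply to the sum over all ways of merging \<open>P\<close> with \<open>Q\<close>.\<close>
    have product: "weyl_scalar (q_var ^ ?wG P) * weyl_x ^ card P * weyl_D ^ card P *
        (weyl_scalar (q_var ^ ?wH Q) * weyl_x ^ card Q * weyl_D ^ card Q) =
        (\<Sum>T\<in>matchings P Q. ?term (merge_along T P Q))"
      if P: "P \<in> independent_partitions G" and Q: "Q \<in> independent_partitions H" for P Q
    proof -
      let ?xs = "increasing_list r P" and ?ys = "increasing_list r Q"
      have part: "partition_on (verts G) P" "partition_on (verts H) Q" and "P \<subseteq> S" "Q \<subseteq> S"
        using P Q S by (auto simp: independent_partitions_def)
      then have xs: "set ?xs = P" "distinct ?xs" and ys: "set ?ys = Q" "distinct ?ys"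
        using increasing_list[OF assms(2)] finite_elements[OF fin(1)] finite_elements[OF fin(2)] by simp_all
      have weight: "partition_weight_at r n w (merge_along T P Q) = ?wG P + ?wH Q
          + matrix_weight (merge_matrix (merge_along T P Q) ?xs ?ys)" if "T \<in> matchings P Q" for T
      proof -
        have "w \<noteq> [X, D]"
          using reducible by (auto simp: dyck_irreducible_def)
        then show ?thesis
          using less.prems(1) reducible induced_merge_along[OF part disj that]
          by (subst partition_weight_at.simps)
            (simp add: Let_def flip: u_def v_def m_def G_def H_def)
      qed
      let ?s = "weyl_scalar (q_var ^ ?wG P)" and ?t = "weyl_scalar (q_var ^ ?wH Q)"
      have "?s * weyl_x ^ card P * weyl_D ^ card P * (?t * weyl_x ^ card Q * weyl_D ^ card Q) =
          ?s * (weyl_x ^ card P * weyl_D ^ card P * ?t) * (weyl_x ^ card Q * weyl_D ^ card Q)"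
        by (simp only: mult.assoc)
      also have "\<dots> = ?s * ?t * (weyl_x ^ card P * weyl_D ^ card P * (weyl_x ^ card Q * weyl_D ^ card Q))"
        unfolding weyl_scalar_commute[of "weyl_x ^ card P * weyl_D ^ card P"] by (simp only: mult.assoc)
      also have "\<dots> = (\<Sum>T\<in>matchings P Q. ?term (merge_along T P Q))"
        unfolding normal_order_merge[OF part disj xs ys] sum_distrib_left
        by (intro sum.cong refl) (simp only: weight power_add weyl_scalar_mult mult.assoc)
      finally show ?thesis .
    qed
    have "weyl_word w = weyl_word u * weyl_word v"
      by (subst split(1)) (rule weyl_word_append)
    also have "\<dots> = (\<Sum>P\<in>independent_partitions G. \<Sum>Q\<in>independent_partitions H.
        \<Sum>T\<in>matchings P Q. ?term (merge_along T P Q))"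
      unfolding IH sum_product by (intro sum.cong refl product)
    also have "\<dots> = (\<Sum>R\<in>independent_partitions (dyck_graph_at n w). ?term R)"
      unfolding graph by (rule sum_independent_partitions_graph_union[OF disj wfG(2) wfH(2) fin, symmetric])
    finally show ?thesis .
  qed
qed

text \<open>By uniqueness of normally ordered expansions, any finite expansion gives the q-Stirling numbers.\<close>

lemma q_stirling_eqI:
  assumes "finite {k. S k \<noteq> 0}"
    and "weyl_word w = (\<Sum>k | S k \<noteq> 0. weyl_scalar (S k) * weyl_x ^ k * weyl_D ^ k)"
  shows "q_stirling w = S"
  unfolding q_stirling_def
proof (rule the_equality)
  fix T assume T: "finite {k. T k \<noteq> 0} \<and>
    weyl_word w = (\<Sum>k | T k \<noteq> 0. weyl_scalar (T k) * weyl_x ^ k * weyl_D ^ k)"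
  show "T = S"
    by (rule normal_order_unique[of "{k. T k \<noteq> 0}" "{k. S k \<noteq> 0}"]) (use T assms in auto)
qed (use assms in blast)

theorem theorem2p12:
  fixes w :: "letter list" and k :: nat and r :: "(nat set \<times> nat set) set"
  assumes "dyck w"
    and "linear_order_on {I. independent_set (dyck_graph w) I} r"
  shows "(\<Sum>P \<in> indep_partitions w k. q_var ^ partition_weight r w P) = q_stirling w k"
proof -
  let ?IP = "independent_partitions (dyck_graph w)"
  define S where "S k = (\<Sum>P\<in>indep_partitions w k. q_var ^ partition_weight r w P)" for k
  \<comment> \<open>Grouping the monomials of the expansion by the number of parts collects the coefficients.\<close>
  have fibre: "indep_partitions w k = {P \<in> ?IP. card P = k}" for k
    by (auto simp: indep_partitions_def independent_partitions_def)
  have fin: "finite ?IP"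
    using finite_subset[OF dyck_graph_at_wf(1)[OF assms(1), of 0]]
    by (intro finite_independent_partitions) (simp add: dyck_graph_def)
  have S0: "S k = 0" if "k \<notin> card ` ?IP" for k
    unfolding S_def fibre using that by (intro sum.neutral) auto
  then have supp: "{k. S k \<noteq> 0} \<subseteq> card ` ?IP"
    by blast
  have "weyl_word w = (\<Sum>P\<in>?IP. weyl_scalar (q_var ^ partition_weight r w P) * weyl_x ^ card P * weyl_D ^ card P)"
    using weyl_word_expansion[OF assms, of 0] by (simp add: dyck_graph_def partition_weight_def)
  also have "\<dots> = (\<Sum>k\<in>card ` ?IP. \<Sum>P | P \<in> ?IP \<and> card P = k.
      weyl_scalar (q_var ^ partition_weight r w P) * weyl_x ^ card P * weyl_D ^ card P)"
    by (rule sum.image_gen[OF fin])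
  also have "\<dots> = (\<Sum>k\<in>card ` ?IP. weyl_scalar (S k) * weyl_x ^ k * weyl_D ^ k)"
    unfolding S_def fibre weyl_scalar_sum sum_distrib_right by (intro sum.cong refl) auto
  also have "\<dots> = (\<Sum>k | S k \<noteq> 0. weyl_scalar (S k) * weyl_x ^ k * weyl_D ^ k)"
    using fin supp by (intro sum.mono_neutral_right) auto
  finally have "q_stirling w = S"
    using finite_subset[OF supp] fin by (intro q_stirling_eqI) auto
  then show ?thesis
    by (simp add: S_def)
qed

end
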